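(* Let $r\ne s$ be positive integers and $n=3r+2s$. The Shabat polynomials of the two trees with passport $[r^3,s^2;5,1^{n-5};n]$ are (up to equivalence) $$P(x)=(x^3+x^2+cx+a)^r(x^2+x+b)^s,$$ where $$a=\frac{-7s^3+(96d+r)s^2+(48dr+51r^2)s-144r^2d+51r^3}{96s(3r+2s)^2},$$ $$b=\frac{27r^2+(-24d+34s)r-48sd+11s^2}{72r^2+48rs},\qquad c=\frac{3d}{3r+2s},$$ and $d$ is a root of $$D(x)=(6912r^2+18432rs+9216s^2)x^2+(-4320r^3-13824r^2s-12768rs^2-3648s^3)x+651r^4+2460r^3s+3210r^2s^2+1772rs^3+355s^4,$$ the two roots of $D$ giving the two trees.
   Context: A Shabat polynomial is a complex polynomial with at most two finite critical values $c_1,c_2$. Its tree is the bicolored plane tree $P^{-1}([c_1,c_2])$, with black vertices the points of $P^{-1}(c_1)$, white vertices the points of $P^{-1}(c_2)$, edges the connected components of the preimage of the open segment $(c_1,c_2)$, and vertex degree equal to the multiplicity of the corresponding root of $P-c_1$ or $P-c_2$. Two Shabat polynomials $P,Q$ (with ordered critical values $c_{1,1},c_{1,2}$ and $c_{2,1},c_{2,2}$) are equivalent if $Q(x)=AP(ax+b)+B$ with $A,a\ne 0$ and $c_{2,j}=Ac_{1,j}+B$ for $j=1,2$; bicolored plane trees (up to color- and orientation-preserving isomorphism) correspond bijectively to Shabat polynomials up to equivalence. The passport $[\alpha;\beta;n]$ of a tree with $n$ edges records the partition $\alpha\vdash n$ of black vertex degrees and $\beta\vdash n$ of white vertex degrees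 ($k^m$ means $k$ repeated $m$ times). For $r\neq s$ there are exactly two trees with passport $[r^3,s^2;5,1^{n-5};n]$. In the claim, $c_1=0$ (black vertices are the roots of $P$). *)

theory Defs
  imports "HOL-Analysis.Analysis" "HOL-Computational_Algebra.Polynomial" "HOL-Library.Multiset"
begin

text \<open>
  The critical values are ordered: \<open>c1\<close> is the value at the black vertices, \<open>c2\<close> the value at the
  white ones.
\<close>

definition shabat :: "complex poly \<Rightarrow> complex \<Rightarrow> complex \<Rightarrow> bool" where
  "shabat P c1 c2 \<longleftrightarrow> degree P > 0 \<and> c1 \<noteq> c2 \<and>
     (\<forall>z. poly (pderiv P) z = 0 \<longrightarrow> poly P z \<in> {c1, c2})"

definition shabat_equiv ::
  "complex poly \<Rightarrow> complex \<Rightarrow> complex \<Rightarrow> complex poly \<Rightarrow> complex \<Rightarrow> complex \<Rightarrow> bool" where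
  "shabat_equiv P c11 c12 Q c21 c22 \<longleftrightarrow>
     (\<exists>A a B b. A \<noteq> 0 \<and> a \<noteq> 0 \<and> Q = smult A (pcompose P [:b, a:]) + [:B:] \<and>
        c21 = A * c11 + B \<and> c22 = A * c12 + B)"

text \<open>
  The plane structure of a bicolored tree is the counterclockwise cyclic order of the edges at every
  vertex: \<open>black_next T e e'\<close> says that \<open>e'\<close> follows \<open>e\<close> in the counterclockwise order around the
  black end of \<open>e\<close>; \<open>white_next\<close> does the same for the white end.
\<close>

record ('v, 'e) bicolored_tree =
  black :: "'v set"
  white :: "'v set"
  edges :: "'e set"
  incident :: "'v \<Rightarrow> 'e \<Rightarrow> bool"
  vdegree :: "'v \<Rightarrow> nat"
  black_next :: "'e \<Rightarrow> 'e \<Rightarrow> bool"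
  white_next :: "'e \<Rightarrow> 'e \<Rightarrow> bool"

definition tree_iso :: "('v, 'e) bicolored_tree \<Rightarrow> ('w, 'f) bicolored_tree \<Rightarrow> bool" where
  "tree_iso T U \<longleftrightarrow>
     (\<exists>f g. bij_betw f (black T \<union> white T) (black U \<union> white U) \<and>
        f ` black T = black U \<and> f ` white T = white U \<and>
        bij_betw g (edges T) (edges U) \<and>
        (\<forall>v\<in>black T \<union> white T. \<forall>e\<in>edges T. incident T v e \<longleftrightarrow> incident U (f v) (g e)) \<and>
        (\<forall>e\<in>edges T. \<forall>e'\<in>edges T. black_next T e e' \<longleftrightarrow> black_next U (g e) (g e')) \<and>
        (\<forall>e\<in>edges T. \<forall>e'\<in>edges T. white_next T e e' \<longleftrightarrow> white_next U (g e) (g e')))"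

definition has_passport ::
  "('v, 'e) bicolored_tree \<Rightarrow> nat multiset \<Rightarrow> nat multiset \<Rightarrow> nat \<Rightarrow> bool" where
  "has_passport T \<alpha> \<beta> n \<longleftrightarrow>
     finite (black T) \<and> finite (white T) \<and> finite (edges T) \<and> card (edges T) = n \<and>
     image_mset (vdegree T) (mset_set (black T)) = \<alpha> \<and>
     image_mset (vdegree T) (mset_set (white T)) = \<beta>"

text \<open>
  \<open>lift_turn P c m e e'\<close>: the circle with center \<open>c\<close> that starts at \<open>m\<close> and is run through once
  counterclockwise has a lift along \<open>P\<close> from a point of \<open>e\<close> to a point of \<open>e'\<close>. If \<open>m\<close> is the
  midpoint of the segment between the critical values and \<open>c\<close> is one of its ends, then the disk of
  this circle contains no critical value other than possibly \<open>c\<close>. On the component of its preimage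
  around a vertex \<open>v\<close> with \<open>P v = c\<close>, the polynomial \<open>P - c\<close> is topologically
  \<open>z \<mapsto> z ^ k\<close> with \<open>k\<close> the multiplicity of \<open>v\<close>, so the lift turns around \<open>v\<close> counterclockwise from an
  edge to the next edge.
\<close>

definition lift_turn ::
  "complex poly \<Rightarrow> complex \<Rightarrow> complex \<Rightarrow> complex set \<Rightarrow> complex set \<Rightarrow> bool" where
  "lift_turn P c m e e' \<longleftrightarrow>
     (\<exists>\<gamma>. path \<gamma> \<and> pathstart \<gamma> \<in> e \<and> pathfinish \<gamma> \<in> e' \<and>
        (\<forall>t\<in>{0..1}. poly P (\<gamma> t) = c + (m - c) * cis (2 * pi * t)))"

definition shabat_tree ::
  "complex poly \<Rightarrow> complex \<Rightarrow> complex \<Rightarrow> (complex, complex set) bicolored_tree" where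
  "shabat_tree P c1 c2 =
     \<lparr> black = {z. poly P z = c1},
       white = {z. poly P z = c2},
       edges = components {z. poly P z \<in> open_segment c1 c2},
       incident = (\<lambda>v e. v \<in> closure e),
       vdegree = (\<lambda>v. order v (P - [:poly P v:])),
       black_next = lift_turn P c1 (midpoint c1 c2),
       white_next = lift_turn P c2 (midpoint c1 c2) \<rparr>"

definition coeff_a :: "complex \<Rightarrow> complex \<Rightarrow> complex \<Rightarrow> complex" where
  "coeff_a r s d =
     (- 7 * s^3 + (96 * d + r) * s^2 + (48 * d * r + 51 * r^2) * s - 144 * r^2 * d + 51 * r^3)
       / (96 * s * (3 * r + 2 * s)^2)"

definition coeff_b :: "complex \<Rightarrow> complex \<Rightarrow> complex \<Rightarrow> complex" where
  "coeff_b r s d =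
     (27 * r^2 + (- 24 * d + 34 * s) * r - 48 * s * d + 11 * s^2) / (72 * r^2 + 48 * r * s)"

definition coeff_c :: "complex \<Rightarrow> complex \<Rightarrow> complex \<Rightarrow> complex" where
  "coeff_c r s d = 3 * d / (3 * r + 2 * s)"

definition D_poly :: "complex \<Rightarrow> complex \<Rightarrow> complex poly" where
  "D_poly r s =
     [: 651 * r^4 + 2460 * r^3 * s + 3210 * r^2 * s^2 + 1772 * r * s^3 + 355 * s^4,
        - 4320 * r^3 - 13824 * r^2 * s - 12768 * r * s^2 - 3648 * s^3,
        6912 * r^2 + 18432 * r * s + 9216 * s^2 :]"

definition P_poly :: "nat \<Rightarrow> nat \<Rightarrow> complex \<Rightarrow> complex poly" where
  "P_poly r s d =
     [: coeff_a (of_nat r) (of_nat s) d, coeff_c (of_nat r) (of_nat s) d, 1, 1 :] ^ r *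
     [: coeff_b (of_nat r) (of_nat s) d, 1, 1 :] ^ s"

end

theory Submission
  imports Defs "HOL-Complex_Analysis.Complex_Analysis"
    "HOL-Computational_Algebra.Fundamental_Theorem_Algebra"
begin

text \<open>
  If \<open>A\<close> is the monic cubic with the black vertices of degree \<open>r\<close> as roots and \<open>B\<close> the monic
  quadratic with those of degree \<open>s\<close>, then \<open>P = A^r B^s\<close> has the required white vertices iff
  \<open>r A' B + s A B' = n (x - z)^4\<close> for some \<open>z\<close>. An affine substitution makes the two subleading
  coefficients equal to 1, unless \<open>A\<close> is a cube; then comparing coefficients determines \<open>z\<close>, gives
  \<open>a\<close>, \<open>b\<close> and \<open>c\<close> in terms of \<open>d\<close>, and leaves \<open>D(d) = 0\<close>. This settles uniqueness and existence up
  to equivalence of polynomials.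

  That the two trees are not isomorphic follows from the rigidity of dessins: an isomorphism of the
  trees of \<open>P\<close> and \<open>Q\<close> (with critical values 0 and 1) yields \<open>P = Q \<circ> h\<close> with \<open>h\<close> affine. Outside the
  vertices, the preimages of the closed upper and of the closed lower half plane split into sheets
  that \<open>P\<close> and \<open>Q\<close> map homeomorphically, and each sheet contains exactly one edge. Match the sheets
  along the bijection of the edges. The cyclic orders at the black and at the white vertices say
  how sheets meet over the rays left of 0 and right of 1, so the pieces of \<open>h\<close> agree there. Hence
  \<open>h\<close> is continuous, so holomorphic, extends over the finitely many vertices, and is proper; it is a
  polynomial, of degree 1 since both trees have the same number of edges.
\<close>

section \<open>Polynomials as coverings\<close>

text \<open>The derivative of \<open>A^r * B^s\<close> is \<open>A^(r-1) * B^(s-1)\<close> times a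
  quartic with leading coefficient \<open>n\<close>. A white vertex of degree 5 absorbs all four
  roots of that quartic, so the remaining white vertices are automatically simple; this is why one
  polynomial identity encodes the whole passport.

  An affine substitution has two free parameters, exactly as many as there are subleading
  coefficients. Once both of these are 1, only the identity preserves the form. Hence different
  roots of \<open>D\<close> give inequivalent polynomials, and the roots are different because the
  discriminant of \<open>D\<close> is a polynomial in \<open>r\<close> and \<open>s\<close> with
  positive coefficients.

  Closed half planes without 0 and 1 are convenient sheets: they are simply connected, cover all
  regular values and share the point 1/2, which serves as base point. They overlap in three real
  intervals. Over the middle one the pieces of \<open>h\<close> agree by construction, so that the
  two cyclic orders are exactly the information needed for the two outer ones.\<close>

lemma rsquarefree_card_roots:
  fixes p :: "complex poly"
  assumes "rsquarefree p"
  shows "card {z. poly p z = 0} = degree p"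
proof -
  have nz: "p \<noteq> 0" using assms by (simp add: rsquarefree_def)
  have "lead_coeff p \<noteq> 0" using nz by simp
  have "degree p = degree (smult (lead_coeff p) (\<Prod>z|poly p z = 0. [:-z, 1:]))"
    using complex_poly_decompose_rsquarefree[OF assms] by simp
  also have "\<dots> = card {z. poly p z = 0}"
    using nz by (simp add: degree_prod_sum_eq poly_roots_finite)
  finally show ?thesis by simp
qed

lemma degree_diff_const: "degree (P - [:w:]) = degree P"
  for P :: "'a::ab_group_add poly"
proof (cases "degree P = 0")
  case True
  then show ?thesis by (metis degree_0_id degree_pCons_0 diff_pCons diff_zero)
next
  case False
  then show ?thesis
    using degree_add_eq_left[of "[:-w:]" P] by (metis add_uminus_conv_diff degree_pCons_0 minus_pCons minus_zero neq0_conv)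
qed

lemma finite_poly_fibre:
  fixes P :: "complex poly"
  assumes "degree P > 0"
  shows "finite {z. poly P z = w}"
proof -
  have "P - [:w:] \<noteq> 0" using assms degree_diff_const[of P w] by auto
  from poly_roots_finite[OF this] show ?thesis by simp
qed

text \<open>If no preimage of \<open>w\<close> is critical, then \<open>P - w\<close> has only
  simple roots. The fibre size is thus the same for all such \<open>w\<close>, which the later
  counting arguments rely on.\<close>

lemma card_poly_fibre:
  fixes P :: "complex poly"
  assumes "\<And>z. poly P z = w \<Longrightarrow> poly (pderiv P) z \<noteq> 0"
  shows "card {z. poly P z = w} = degree P"
proof -
  have "rsquarefree (P - [:w:])"
    unfolding rsquarefree_roots using assms by (auto simp: pderiv_diff)
  from rsquarefree_card_roots[OF this] show ?thesis by (simp add: degree_diff_const)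
qed

lemma poly_fibre_nonempty:
  fixes P :: "complex poly"
  assumes "degree P > 0"
  shows "\<exists>z. poly P z = w"
  using alg_closed_imp_poly_has_root[of "P - [:w:]"] assms by (simp add: degree_diff_const)

lemma holomorphic_on_poly: "poly P holomorphic_on S" for P :: "complex poly"
  unfolding holomorphic_on_def field_differentiable_def
  using poly_DERIV has_field_derivative_at_within by blast

lemma poly_locally_injective:
  fixes P :: "complex poly"
  assumes "poly (pderiv P) z \<noteq> 0"
  obtains e where "e > 0" "inj_on (poly P) (ball z e)"
proof -
  have "deriv (poly P) z \<noteq> 0"
    using assms DERIV_imp_deriv[OF poly_DERIV] by metis
  then show ?thesis
    using has_complex_derivative_locally_injective[of "poly P" UNIV z] that
    by (auto simp: holomorphic_on_poly)
qed

text \<open>The sheets over a value are small disks around its preimages, cut down to a common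
  neighbourhood \<open>U\<close>. That nothing else lies over \<open>U\<close> follows by counting:
  the disks already contribute \<open>degree P\<close> points to each fibre, and no fibre over
  \<open>S\<close> has more.\<close>

lemma covering_space_poly:
  fixes P :: "complex poly"
  assumes deg: "degree P > 0" and "open S"
    and reg: "\<And>z. poly P z \<in> S \<Longrightarrow> poly (pderiv P) z \<noteq> 0"
  shows "covering_space {z. poly P z \<in> S} (poly P) S"
proof
  let ?X = "{z. poly P z \<in> S}"
  show "continuous_on ?X (poly P)" by (intro continuous_intros)
  have oX: "open ?X"
    using continuous_open_vimage[of S "poly P"] \<open>open S\<close> by (simp add: vimage_def continuous_intros)
  show "poly P ` ?X = S"
    using poly_fibre_nonempty[OF deg] by (auto simp: image_iff) metis
  fix w assume w: "w \<in> S"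
  let ?R = "{z. poly P z = w}"
  have fR: "finite ?R" by (rule finite_poly_fibre[OF deg])
  have cR: "card ?R = degree P" using reg w by (intro card_poly_fibre) auto
  have "\<exists>e>0. inj_on (poly P) (ball z e)" if "z \<in> ?R" for z
    using poly_locally_injective[OF reg] w that by (metis mem_Collect_eq)
  then obtain e where e: "\<And>z. z \<in> ?R \<Longrightarrow> e z > 0 \<and> inj_on (poly P) (ball z (e z))"
    by metis
  obtain \<delta> where \<delta>: "\<And>x. \<delta> x > 0" "\<And>x y. y \<in> ?R \<Longrightarrow> y \<noteq> x \<Longrightarrow> \<delta> x \<le> dist x y"
    using finite_set_avoid[OF fR] by metis
  define V where "V = (\<lambda>z. ball z (min (e z) (\<delta> z/2)))"
  have V: "open (V z)" "z \<in> V z" "inj_on (poly P) (V z)" if "z \<in> ?R" for z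
    using e[OF that] \<delta>(1) inj_on_subset[OF _ subset_ball[OF min.cobounded1]]
    by (auto simp: V_def)
  have Vdisj: "V x \<inter> V y = {}" if "x \<in> ?R" "y \<in> ?R" "x \<noteq> y" for x y
  proof (rule ccontr)
    assume "V x \<inter> V y \<noteq> {}"
    then obtain u where "dist x u < \<delta> x/2" "dist y u < \<delta> y/2" by (auto simp: V_def)
    then have "2 * dist x y < \<delta> x + \<delta> y" using dist_triangle2[of x y u] by simp
    moreover have "\<delta> x \<le> dist x y" "\<delta> y \<le> dist x y"
      using \<delta>(2)[of y x] \<delta>(2)[of x y] that by (auto simp: dist_commute)
    ultimately show False by linarith
  qed
  have oPV: "open (poly P ` V z)" if "z \<in> ?R" for z
    using V[OF that] by (intro open_mapping_thm3) (auto simp: holomorphic_on_poly)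
  define U where "U = S \<inter> (\<Inter>z\<in>?R. poly P ` V z)"
  have oU: "open U" unfolding U_def using fR oPV \<open>open S\<close> by auto
  have US: "U \<subseteq> S" by (auto simp: U_def)
  have wU: "w \<in> U" using w V(2) by (auto simp: U_def)
  define v where "v = (\<lambda>z. V z \<inter> {x. poly P x \<in> U}) ` ?R"
  have oPU: "open {x. poly P x \<in> U}"
    using continuous_open_vimage[of U "poly P"] oU by (simp add: vimage_def continuous_intros)
  have cover: "\<exists>z\<in>?R. x \<in> V z" if x: "poly P x \<in> U" for x
  proof -
    \<comment> \<open>\<open>f z\<close> is the point in the disk around \<open>z\<close> that lies
      in the same fibre as \<open>x\<close>.\<close>
    define f where "f = (\<lambda>z. the_inv_into (V z) (poly P) (poly P x))"
    have f: "f z \<in> V z" "poly P (f z) = poly P x" if "z \<in> ?R" for z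
    proof -
      have m: "poly P x \<in> poly P ` V z" using x that by (auto simp: U_def)
      show "f z \<in> V z" unfolding f_def using the_inv_into_into[OF V(3)[OF that] m] by simp
      show "poly P (f z) = poly P x" unfolding f_def by (rule f_the_inv_into_f[OF V(3)[OF that] m])
    qed
    have "inj_on f ?R" using f(1) Vdisj by (intro inj_onI) (metis disjoint_iff)
    then have "card (f ` ?R) = degree P" using cR by (simp add: card_image)
    moreover have "card {y. poly P y = poly P x} = degree P"
      using x reg by (intro card_poly_fibre) (auto simp: U_def)
    moreover have "f ` ?R \<subseteq> {y. poly P y = poly P x}" using f(2) by auto
    ultimately have "f ` ?R = {y. poly P y = poly P x}"
      using finite_poly_fibre[OF deg] by (metis card_subset_eq)
    then have "x \<in> f ` ?R" by simp
    then show ?thesis using f(1) by auto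
  qed
  show "\<exists>T. w \<in> T \<and> openin (top_of_set S) T \<and> (\<exists>v. \<Union> v = ?X \<inter> poly P -` T \<and>
          (\<forall>u\<in>v. openin (top_of_set ?X) u) \<and> pairwise disjnt v \<and>
          (\<forall>u\<in>v. \<exists>q. homeomorphism u T (poly P) q))"
  proof (intro exI[of _ U] conjI exI[of _ v])
    show "openin (top_of_set S) U" using oU US by (simp add: open_subset)
    show "\<Union> v = ?X \<inter> poly P -` U"
    proof
      show "\<Union> v \<subseteq> ?X \<inter> poly P -` U" using US by (auto simp: v_def)
      show "?X \<inter> poly P -` U \<subseteq> \<Union> v"
      proof
        fix x assume "x \<in> ?X \<inter> poly P -` U"
        then have "poly P x \<in> U" by simp
        with cover[OF this] show "x \<in> \<Union> v" by (auto simp: v_def)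
      qed
    qed
    show "\<forall>u\<in>v. openin (top_of_set ?X) u"
    proof
      fix u assume "u \<in> v"
      then obtain z where z: "z \<in> ?R" "u = V z \<inter> {x. poly P x \<in> U}" by (auto simp: v_def)
      then have "open u" using V(1) oPU by auto
      moreover have "u \<subseteq> ?X" using z(2) US by auto
      ultimately show "openin (top_of_set ?X) u" by (rule open_subset[rotated])
    qed
    show "pairwise disjnt v"
      using Vdisj by (auto simp: v_def pairwise_def disjnt_def)
    show "\<forall>u\<in>v. \<exists>q. homeomorphism u U (poly P) q"
    proof
      fix u assume "u \<in> v"
      then obtain z where z: "z \<in> ?R" "u = V z \<inter> {x. poly P x \<in> U}" by (auto simp: v_def)
      have ou: "open u" using z V(1) oPU by auto
      have inj: "inj_on (poly P) u" using V(3)[OF z(1)] z(2) by (auto intro: inj_on_subset)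
      have UV: "U \<subseteq> poly P ` V z" using z(1) unfolding U_def by (rule le_infI2[OF INF_lower])
      have im: "poly P ` u = U"
      proof
        show "U \<subseteq> poly P ` u"
        proof
          fix y assume y: "y \<in> U"
          then obtain x where "x \<in> V z" "y = poly P x" using UV by auto
          then show "y \<in> poly P ` u" using y z(2) by auto
        qed
      qed (auto simp: z(2))
      obtain q where "homeomorphism u (poly P ` u) (poly P) q"
        by (rule invariance_of_domain_homeomorphism[of u "poly P"])
          (use ou inj in \<open>auto intro!: continuous_intros\<close>)
      then show "\<exists>q. homeomorphism u U (poly P) q" unfolding im by blast
    qed
  qed (fact wU)
qed

text \<open>This is the end point of the lift, starting at \<open>x\<close>, of any path inside
  \<open>A\<close> from \<open>poly P x\<close> to \<open>w\<close>. The description by a component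
  avoids choosing a path; it determines a unique point when \<open>A\<close> is a simply connected,
  locally path connected set of regular values.\<close>

definition transport :: "complex poly \<Rightarrow> complex set \<Rightarrow> complex \<Rightarrow> complex \<Rightarrow> complex" where
  "transport P A x w = (THE y. connected_component (poly P -` A) x y \<and> poly P y = w)"

locale regular_poly =
  fixes P :: "complex poly" and S :: "complex set"
  assumes degree_pos: "degree P > 0"
    and open_values: "open S"
    and regular: "\<And>z. poly P z \<in> S \<Longrightarrow> poly (pderiv P) z \<noteq> 0"
begin

lemma covering: "covering_space (poly P -` S) (poly P) S"
  using covering_space_poly[OF degree_pos open_values regular] by (simp add: vimage_def)

text \<open>The identity of \<open>A\<close> lifts to a section \<open>g\<close> through a point of
  \<open>C\<close>, and its connected image stays in \<open>C\<close>. On \<open>C\<close> the maps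
  \<open>g \<circ> poly P\<close> and the identity lift the same map and agree at one point, so they
  coincide.\<close>

lemma sheet:
  assumes A: "A \<subseteq> S" "simply_connected A" "locally path_connected A"
    and C: "C \<in> components (poly P -` A)"
  obtains \<sigma> where "homeomorphism C A (poly P) \<sigma>"
proof -
  obtain x where x: "x \<in> C" using C in_components_nonempty by blast
  have CA: "C \<subseteq> poly P -` A" and conC: "connected C"
    using C in_components_subset in_components_connected by auto
  have xS: "x \<in> poly P -` S" "poly P x \<in> A" using x CA A(1) by auto
  obtain g where g: "continuous_on A g" "g \<in> A \<rightarrow> poly P -` S" "g (poly P x) = x"
      "\<And>y. y \<in> A \<Longrightarrow> poly P (g y) = y"
    using covering_space_lift_strong[OF covering xS A(2,3), of "\<lambda>y. y"] A(1) by auto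
  have gA: "g ` A \<subseteq> C"
  proof (rule components_maximal[OF C])
    show "connected (g ` A)"
      using g(1) A(2) by (simp add: connected_continuous_image simply_connected_imp_connected)
    show "g ` A \<subseteq> poly P -` A" using g(4) by auto
    show "C \<inter> g ` A \<noteq> {}" using g(3) xS x by (metis IntI emptyE imageI)
  qed
  have gP: "g (poly P y) = y" if "y \<in> C" for y
  proof (rule covering_space_lift_unique[OF covering, of "\<lambda>y. g (poly P y)" x "\<lambda>y. y" C "poly P"])
    show "continuous_on C (\<lambda>y. g (poly P y))"
      by (rule continuous_on_compose2[OF g(1)]) (use CA in \<open>auto intro!: continuous_intros\<close>)
    show "(\<lambda>y. g (poly P y)) \<in> C \<rightarrow> poly P -` S" using g(2) CA by auto
  qed (use g x CA A conC that in \<open>auto intro!: continuous_intros\<close>)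
  have "C \<subseteq> g ` A"
  proof
    fix y assume y: "y \<in> C"
    then have "g (poly P y) = y" "poly P y \<in> A" using gP CA by auto
    then show "y \<in> g ` A" by (metis imageI)
  qed
  then have "g ` A = C" using gA by simp
  moreover have "A \<subseteq> poly P ` C"
  proof
    fix y assume y: "y \<in> A"
    then have "poly P (g y) = y" "g y \<in> C" using g(4) gA by auto
    then show "y \<in> poly P ` C" by (metis imageI)
  qed
  then have "poly P ` C = A" using CA by auto
  ultimately have "homeomorphism C A (poly P) g"
    unfolding homeomorphism_def using gP g by (auto intro!: continuous_intros)
  then show thesis by (rule that)
qed

lemma sheet_ex1:
  assumes A: "A \<subseteq> S" "simply_connected A" "locally path_connected A"
    and x: "poly P x \<in> A" and w: "w \<in> A"
  shows "\<exists>!y. connected_component (poly P -` A) x y \<and> poly P y = w"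
proof -
  let ?C = "connected_component_set (poly P -` A) x"
  have "?C \<in> components (poly P -` A)" using x by (simp add: componentsI)
  then obtain \<sigma> where \<sigma>: "homeomorphism ?C A (poly P) \<sigma>" using sheet[OF A] by blast
  show ?thesis
  proof (rule ex1I[of _ "\<sigma> w"])
    show "connected_component (poly P -` A) x (\<sigma> w) \<and> poly P (\<sigma> w) = w"
      using \<sigma> w by (auto simp: homeomorphism_def)
    show "y = \<sigma> w" if "connected_component (poly P -` A) x y \<and> poly P y = w" for y
      using \<sigma> that by (auto simp: homeomorphism_def)
  qed
qed

context
  fixes A assumes A: "A \<subseteq> S" "simply_connected A" "locally path_connected A"
begin

lemma transport_component:
  assumes "poly P x \<in> A" "w \<in> A"
  shows "connected_component (poly P -` A) x (transport P A x w)"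
    and poly_transport: "poly P (transport P A x w) = w"
  using theI'[OF sheet_ex1[OF A assms]] by (simp_all add: transport_def)

lemma transport_unique:
  assumes "connected_component (poly P -` A) x y" "poly P y = w"
  shows "transport P A x w = y"
proof -
  have "poly P x \<in> A" "poly P y \<in> A"
    using connected_component_in[OF assms(1)] by auto
  then show ?thesis
    using the1_equality[OF sheet_ex1[OF A, of x w]] assms by (simp add: transport_def)
qed

lemma transport_self:
  assumes "poly P x \<in> A"
  shows "transport P A x (poly P x) = x"
  using assms by (intro transport_unique) auto

lemma transport_refl:
  assumes "poly P x = w" "w \<in> A"
  shows "transport P A x w = x"
  using transport_self[of x] assms by simp

lemma transport_transport:
  assumes "poly P x \<in> A" "v \<in> A" "w \<in> A"
  shows "transport P A (transport P A x v) w = transport P A x w"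
proof -
  have "connected_component (poly P -` A) (transport P A x v) (transport P A x w)"
    by (rule connected_component_trans[OF connected_component_sym
          [OF transport_component(1)[OF assms(1,2)]] transport_component(1)[OF assms(1,3)]])
  then show ?thesis using poly_transport[OF assms(1,3)] by (rule transport_unique)
qed

lemma transport_back:
  assumes "poly P x \<in> A" "v \<in> A" "poly P x = w"
  shows "transport P A (transport P A x v) w = x"
  using transport_transport[of x v w] transport_self[of x] assms by simp

lemma continuous_on_transport:
  assumes "poly P x \<in> A"
  shows "continuous_on A (transport P A x)"
proof -
  let ?C = "connected_component_set (poly P -` A) x"
  have "?C \<in> components (poly P -` A)" using assms by (simp add: componentsI)
  then obtain \<sigma> where \<sigma>: "homeomorphism ?C A (poly P) \<sigma>" using sheet[OF A] by blast
  then have "transport P A x w = \<sigma> w" if "w \<in> A" for w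
    using that by (intro transport_unique) (auto simp: homeomorphism_def)
  then show ?thesis using \<sigma> by (simp add: homeomorphism_def cong: continuous_on_cong)
qed

text \<open>Every component meets the finite fibre over a fixed point of \<open>A\<close>.
  Finiteness makes the components relatively open, since each one is the complement of finitely many
  closed ones.\<close>

lemma finite_components_vimage: "finite (components (poly P -` A))"
proof (cases "A = {}")
  case False
  then obtain m where m: "m \<in> A" by auto
  have "components (poly P -` A) \<subseteq> connected_component_set (poly P -` A) ` {z. poly P z = m}"
  proof
    fix C assume "C \<in> components (poly P -` A)"
    then obtain x where x: "poly P x \<in> A" "C = connected_component_set (poly P -` A) x"
      by (auto simp: components_def)
    have "C = connected_component_set (poly P -` A) (transport P A x m)"
      using connected_component_eq[of "transport P A x m" "poly P -` A" x]
        transport_component(1)[OF x(1) m] x(2) by simp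
    then show "C \<in> connected_component_set (poly P -` A) ` {z. poly P z = m}"
      using poly_transport[OF x(1) m] by auto
  qed
  then show ?thesis using finite_poly_fibre[OF degree_pos] by (meson finite_imageI finite_subset)
qed auto

end

text \<open>A circle around a critical value lies in no single simply connected set of regular
  values, but each of its halves may. Lifting it then amounts to two successive transports, and
  statements about paths become equations.\<close>

lemma lift_iff_transport:
  assumes A: "A \<subseteq> S" "simply_connected A" "locally path_connected A"
    and B: "B \<subseteq> S" "simply_connected B" "locally path_connected B"
    and \<kappa>: "continuous_on {0..1::real} \<kappa>" "\<kappa> ` {0..1/2} \<subseteq> A" "\<kappa> ` {1/2..1} \<subseteq> B"
    and \<mu>: "poly P \<mu> = \<kappa> 0"
  shows "(\<exists>\<gamma>. path \<gamma> \<and> pathstart \<gamma> = \<mu> \<and> pathfinish \<gamma> = \<nu> \<and> (\<forall>t\<in>{0..1}. poly P (\<gamma> t) = \<kappa> t))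
     \<longleftrightarrow> \<nu> = transport P B (transport P A \<mu> (\<kappa> (1/2))) (\<kappa> 1)"
proof -
  let ?x = "transport P A \<mu> (\<kappa> (1/2))"
  have kA: "\<kappa> t \<in> A" if "0 \<le> t" "t \<le> 1/2" for t using \<kappa>(2) that by auto
  have kB: "\<kappa> t \<in> B" if "1/2 \<le> t" "t \<le> 1" for t using \<kappa>(3) that by auto
  have \<mu>A: "poly P \<mu> \<in> A" using \<mu> kA by simp
  have Px: "poly P ?x = \<kappa> (1/2)" using poly_transport[OF A \<mu>A] kA by simp
  have xB: "poly P ?x \<in> B" using kB Px by simp
  show ?thesis
  proof
    assume "\<exists>\<gamma>. path \<gamma> \<and> pathstart \<gamma> = \<mu> \<and> pathfinish \<gamma> = \<nu> \<and> (\<forall>t\<in>{0..1}. poly P (\<gamma> t) = \<kappa> t)"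
    then obtain \<gamma> where \<gamma>: "continuous_on {0..1} \<gamma>" "\<gamma> 0 = \<mu>" "\<gamma> 1 = \<nu>"
        "\<And>t. t \<in> {0..1} \<Longrightarrow> poly P (\<gamma> t) = \<kappa> t"
      by (auto simp: path_def pathstart_def pathfinish_def)
    have "?x = \<gamma> (1/2)"
    proof (rule transport_unique[OF A])
      show "connected_component (poly P -` A) \<mu> (\<gamma> (1/2))"
      proof (rule connected_componentI)
        show "connected (\<gamma> ` {0..1/2})"
          by (intro connected_continuous_image continuous_on_subset[OF \<gamma>(1)]) auto
        show "\<gamma> ` {0..1/2} \<subseteq> poly P -` A" using \<gamma>(4) kA by auto
        show "\<mu> \<in> \<gamma> ` {0..1/2}" using \<gamma>(2) by force
      qed auto
    qed (use \<gamma> in auto)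
    moreover have "transport P B (\<gamma> (1/2)) (\<kappa> 1) = \<nu>"
    proof (rule transport_unique[OF B])
      show "connected_component (poly P -` B) (\<gamma> (1/2)) \<nu>"
      proof (rule connected_componentI)
        show "connected (\<gamma> ` {1/2..1})"
          by (intro connected_continuous_image continuous_on_subset[OF \<gamma>(1)]) auto
        show "\<gamma> ` {1/2..1} \<subseteq> poly P -` B" using \<gamma>(4) kB by auto
        show "\<nu> \<in> \<gamma> ` {1/2..1}" using \<gamma>(3) by force
      qed auto
    qed (use \<gamma> in force)
    ultimately show "\<nu> = transport P B ?x (\<kappa> 1)" by simp
  next
    assume \<nu>: "\<nu> = transport P B ?x (\<kappa> 1)"
    define \<gamma> where "\<gamma> = (\<lambda>t. if t \<le> 1/2 then transport P A \<mu> (\<kappa> t) else transport P B ?x (\<kappa> t))"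
    have "continuous_on ({0..1/2} \<union> {1/2..1}) \<gamma>"
      unfolding \<gamma>_def
    proof (rule continuous_on_cases)
      show "continuous_on {0..1/2} (\<lambda>t. transport P A \<mu> (\<kappa> t))"
        using \<kappa> by (intro continuous_on_compose2[OF continuous_on_transport[OF A \<mu>A]]
            continuous_on_subset[OF \<kappa>(1)]) auto
      show "continuous_on {1/2..1} (\<lambda>t. transport P B ?x (\<kappa> t))"
        using \<kappa> by (intro continuous_on_compose2[OF continuous_on_transport[OF B xB]]
            continuous_on_subset[OF \<kappa>(1)]) auto
      have half: "transport P A \<mu> (\<kappa> t) = transport P B ?x (\<kappa> t)" if "t = 1/2" for t
        using transport_self[OF B xB] unfolding Px that by simp
      show "\<forall>t. t \<in> {0..1/2} \<and> \<not> t \<le> 1/2 \<or> t \<in> {1/2..1} \<and> t \<le> 1/2 \<longrightarrow>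
          transport P A \<mu> (\<kappa> t) = transport P B ?x (\<kappa> t)"
      proof (intro allI impI)
        fix t :: real
        assume "t \<in> {0..1/2} \<and> \<not> t \<le> 1/2 \<or> t \<in> {1/2..1} \<and> t \<le> 1/2"
        then have "t = 1/2" by auto
        then show "transport P A \<mu> (\<kappa> t) = transport P B ?x (\<kappa> t)" by (rule half)
      qed
    qed auto
    then have "path \<gamma>" by (simp add: path_def ivl_disj_un_two_touch)
    moreover have "poly P (\<gamma> t) = \<kappa> t" if "t \<in> {0..1}" for t
      using that poly_transport[OF A \<mu>A kA[of t]] poly_transport[OF B xB kB[of t]]
      by (auto simp: \<gamma>_def)
    moreover have "\<gamma> 0 = \<mu>" using transport_self[OF A \<mu>A] \<mu> by (simp add: \<gamma>_def)
    moreover have "\<gamma> 1 = \<nu>" using \<nu> by (simp add: \<gamma>_def)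
    ultimately show "\<exists>\<gamma>. path \<gamma> \<and> pathstart \<gamma> = \<mu> \<and> pathfinish \<gamma> = \<nu> \<and>
        (\<forall>t\<in>{0..1}. poly P (\<gamma> t) = \<kappa> t)"
      by (auto simp: pathstart_def pathfinish_def)
  qed
qed

lemma components_lift:
  assumes A: "A \<subseteq> S" "simply_connected A" "locally path_connected A"
    and m: "m \<in> A" and e: "e \<in> components (poly P -` A)"
  shows "\<exists>!z. z \<in> e \<and> poly P z = m"
proof -
  obtain x where x: "poly P x \<in> A" "e = connected_component_set (poly P -` A) x"
    using e by (auto simp: components_def)
  then show ?thesis using sheet_ex1[OF A x(1) m] by simp
qed

text \<open>Each component contains exactly one point over a fixed \<open>m\<close>, so the
  components correspond to a fibre. For the open segment between the critical values this counts the
  edges.\<close>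

lemma card_components_vimage:
  assumes A: "A \<subseteq> S" "simply_connected A" "locally path_connected A" and "A \<noteq> {}"
  shows "card (components (poly P -` A)) = degree P"
proof -
  obtain m where m: "m \<in> A" using \<open>A \<noteq> {}\<close> by auto
  have "bij_betw (connected_component_set (poly P -` A)) {z. poly P z = m} (components (poly P -` A))"
  proof (rule bij_betwI')
    fix x y assume xy: "x \<in> {z. poly P z = m}" "y \<in> {z. poly P z = m}"
    show "(connected_component_set (poly P -` A) x = connected_component_set (poly P -` A) y) = (x = y)"
    proof
      assume eq: "connected_component_set (poly P -` A) x = connected_component_set (poly P -` A) y"
      have "y \<in> poly P -` A" using xy m by auto
      then have "y \<in> connected_component_set (poly P -` A) y" by simp
      then have "y \<in> connected_component_set (poly P -` A) x" by (simp only: eq)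
      then have "connected_component (poly P -` A) x y" by simp
      then have "transport P A x m = y" using xy by (intro transport_unique[OF A]) auto
      moreover have "transport P A x m = x" using transport_self[OF A, of x] xy m by auto
      ultimately show "x = y" by simp
    qed auto
  next
    fix x assume "x \<in> {z. poly P z = m}"
    then show "connected_component_set (poly P -` A) x \<in> components (poly P -` A)"
      using m by (auto intro: componentsI)
  next
    fix C assume "C \<in> components (poly P -` A)"
    then obtain x where x: "poly P x \<in> A" "C = connected_component_set (poly P -` A) x"
      by (auto simp: components_def)
    have "C = connected_component_set (poly P -` A) (transport P A x m)"
      using connected_component_eq[of "transport P A x m" "poly P -` A" x]
        transport_component(1)[OF A x(1) m] x(2) by simp
    then show "\<exists>z\<in>{z. poly P z = m}. C = connected_component_set (poly P -` A) z"
      using poly_transport[OF A x(1) m] by blast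
  qed
  then have "card (components (poly P -` A)) = card {z. poly P z = m}"
    by (simp add: bij_betw_same_card)
  also have "\<dots> = degree P" using regular m A(1) by (intro card_poly_fibre) auto
  finally show ?thesis .
qed

end

section \<open>Gluing the sheets over two half planes\<close>

text \<open>The counterpart of \<open>lift_turn\<close> for critical values 0 and 1, with points
  over the midpoint 1/2 in place of edges; each edge contains exactly one such point.\<close>

definition turn :: "complex poly \<Rightarrow> complex \<Rightarrow> complex \<Rightarrow> complex \<Rightarrow> bool" where
  "turn P c \<mu> \<nu> \<longleftrightarrow> (\<exists>\<gamma>. path \<gamma> \<and> pathstart \<gamma> = \<mu> \<and> pathfinish \<gamma> = \<nu> \<and>
     (\<forall>t\<in>{0..1}. poly P (\<gamma> t) = c + (1/2 - c) * cis (2 * pi * t)))"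

text \<open>The half planes are closed so that together they cover all values except 0 and 1 and
  overlap along the real axis, where the two pieces of the map are compared.\<close>

definition upper :: "complex set" where "upper = {z. Im z \<ge> 0} \<inter> - {0, 1}"
definition lower :: "complex set" where "lower = {z. Im z \<le> 0} \<inter> - {0, 1}"

text \<open>Removing 0 and 1 destroys convexity, but the set stays star-shaped about
  \<open>\<i>\<close>: a segment from \<open>\<i>\<close> can reach the real axis only at its other
  end.\<close>

lemma upper_sheet: "upper \<subseteq> - {0, 1}" "simply_connected upper" "locally path_connected upper"
proof -
  show "upper \<subseteq> - {0, 1}" by (auto simp: upper_def)
  have "starlike upper"
    unfolding starlike_def
  proof (intro bexI ballI subsetI)
    fix x z assume "x \<in> upper" "z \<in> closed_segment \<i> x"
    then obtain u where u: "0 \<le> u" "u \<le> 1" "z = (1 - u) *\<^sub>R \<i> + u *\<^sub>R x"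
      by (auto simp: in_segment)
    show "z \<in> upper"
    proof (cases "u = 1")
      case False
      then have "1 - u > 0" "u * Im x \<ge> 0" using u \<open>x \<in> upper\<close> by (auto simp: upper_def)
      then have "Im z > 0" using u by simp
      then show ?thesis by (auto simp: upper_def)
    qed (use u \<open>x \<in> upper\<close> in simp)
  qed (auto simp: upper_def)
  then show "simply_connected upper" by (rule starlike_imp_simply_connected)
  show "locally path_connected upper"
    unfolding upper_def
    by (rule locally_open_subset[OF convex_imp_locally_path_connected[OF convex_halfspace_Im_ge[of 0]]])
      (auto intro!: openin_open_Int)
qed

lemma lower_sheet: "lower \<subseteq> - {0, 1}" "simply_connected lower" "locally path_connected lower"
proof -
  show "lower \<subseteq> - {0, 1}" by (auto simp: lower_def)
  have "starlike lower"
    unfolding starlike_def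
  proof (intro bexI ballI subsetI)
    fix x z assume "x \<in> lower" "z \<in> closed_segment (-\<i>) x"
    then obtain u where u: "0 \<le> u" "u \<le> 1" "z = (1 - u) *\<^sub>R (-\<i>) + u *\<^sub>R x"
      by (auto simp: in_segment)
    show "z \<in> lower"
    proof (cases "u = 1")
      case False
      then have "1 - u > 0" "u * Im x \<le> 0"
        using u \<open>x \<in> lower\<close> by (auto simp: lower_def mult_nonneg_nonpos)
      then have "Im z < 0" using u by simp
      then show ?thesis by (auto simp: lower_def)
    qed (use u \<open>x \<in> lower\<close> in simp)
  qed (auto simp: lower_def complex_eq_iff)
  then show "simply_connected lower" by (rule starlike_imp_simply_connected)
  show "locally path_connected lower"
    unfolding lower_def
    by (rule locally_open_subset[OF convex_imp_locally_path_connected[OF convex_halfspace_Im_le[of 0]]])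
      (auto intro!: openin_open_Int)
qed

lemma half_circle:
  assumes c: "c = 0 \<or> c = (1::real)" and t: "0 \<le> t" "t \<le> 1"
  defines "z \<equiv> complex_of_real c + (1/2 - complex_of_real c) * cis (2 * pi * t)"
  shows "z \<noteq> 0" "z \<noteq> 1" "Im z = (1/2 - c) * sin (2 * pi * t)"
proof -
  have "cmod (z - c) = 1/2"
    using c by (auto simp: z_def norm_mult)
  then show "z \<noteq> 0" "z \<noteq> 1" using c by (auto simp: norm_minus_commute)
  show "Im z = (1/2 - c) * sin (2 * pi * t)" using c by (auto simp: z_def)
qed

lemma sin_first_half: "0 \<le> t \<Longrightarrow> t \<le> 1/2 \<Longrightarrow> sin (2 * pi * t) \<ge> 0"
  by (intro sin_ge_zero) (auto simp: field_simps)

lemma sin_second_half: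
  assumes "1/2 \<le> t" "t \<le> 1" shows "sin (2 * pi * t) \<le> 0"
proof -
  have "sin (2 * pi * t - pi) \<ge> 0" using assms by (intro sin_ge_zero) (auto simp: field_simps)
  then show ?thesis by (simp add: sin_diff)
qed

text \<open>
  Walk from \<open>x\<close> inside its sheet over \<open>A\<close> to the point over \<open>1/2\<close> on its edge, pass to the
  corresponding edge of the other tree, and walk from there to the point over \<open>poly P x\<close>.
\<close>

definition glue_map ::
  "complex poly \<Rightarrow> complex poly \<Rightarrow> (complex \<Rightarrow> complex) \<Rightarrow> complex set \<Rightarrow> complex \<Rightarrow> complex" where
  "glue_map P Q G A x = transport Q A (G (transport P A x (1/2))) (poly P x)"

text \<open>\<open>G\<close> stands for the edge map of a tree isomorphism, read off on the points
  over 1/2. Its compatibility with \<open>turn\<close> at 0 and at 1 expresses the cyclic orders at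
  the black and at the white vertices.\<close>

locale regular_poly_pair =
  P: regular_poly P "- {0, 1}" + Q: regular_poly Q "- {0, 1}" for P Q +
  fixes G :: "complex \<Rightarrow> complex"
  assumes G: "poly P \<mu> = 1/2 \<Longrightarrow> poly Q (G \<mu>) = 1/2"
    and turn_G: "c = 0 \<or> c = 1 \<Longrightarrow> turn P c \<mu> \<nu> \<Longrightarrow> turn Q c (G \<mu>) (G \<nu>)"
begin

context
  fixes A :: "complex set"
  assumes A: "A \<subseteq> - {0, 1}" "simply_connected A" "locally path_connected A" "1/2 \<in> A"
begin

lemma base_G:
  assumes "poly P x \<in> A"
  shows "poly Q (G (transport P A x (1/2))) = 1/2"
  using P.poly_transport[OF A(1-3) assms A(4)] by (rule G)

lemma poly_glue_map:
  assumes "poly P x \<in> A"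
  shows "poly Q (glue_map P Q G A x) = poly P x"
  unfolding glue_map_def
  by (rule Q.poly_transport[OF A(1-3)]) (simp_all only: base_G[OF assms] A(4) assms)

text \<open>All points of one component have the same base point over 1/2, so there the map is a
  fixed branch of transport in \<open>Q\<close> after \<open>poly P\<close>. The components are
  relatively open because there are finitely many of them.\<close>

lemma continuous_on_glue_map: "continuous_on (poly P -` A) (glue_map P Q G A)"
proof (rule continuous_on_components_gen)
  fix C assume C: "C \<in> components (poly P -` A)"
  have fin: "finite (components (poly P -` A))" by (rule P.finite_components_vimage[OF A(1-3)])
  have "openin (top_of_set (poly P -` A)) C"
  proof -
    have eq: "C = poly P -` A - \<Union>(components (poly P -` A) - {C})"
    proof -
      have out: "x \<notin> D" if "x \<in> C" "D \<in> components (poly P -` A) - {C}" for x D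
        using components_nonoverlap[of C "poly P -` A" D] C that by auto
      have inC: "x \<in> C" if "x \<in> poly P -` A - \<Union>(components (poly P -` A) - {C})" for x
      proof -
        let ?D = "connected_component_set (poly P -` A) x"
        have "?D \<in> components (poly P -` A)" "x \<in> ?D" using that by (auto intro: componentsI)
        moreover have "?D \<notin> components (poly P -` A) - {C}"
          using that \<open>x \<in> ?D\<close> by (meson DiffD2 UnionI)
        ultimately have "?D = C" by blast
        then show ?thesis using \<open>x \<in> ?D\<close> by simp
      qed
      have sub: "C \<subseteq> poly P -` A" using C by (rule in_components_subset)
      show ?thesis
      proof (intro equalityI subsetI)
        fix x assume x: "x \<in> C"
        show "x \<in> poly P -` A - \<Union>(components (poly P -` A) - {C})"
          using x sub out[OF x] by (intro DiffI) (auto simp del: vimage_eq)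
      qed (rule inC)
    qed
    have "closedin (top_of_set (poly P -` A)) (\<Union>(components (poly P -` A) - {C}))"
      using fin by (intro closedin_Union) (auto intro: closedin_component)
    then have o: "openin (top_of_set (poly P -` A)) (poly P -` A - \<Union>(components (poly P -` A) - {C}))"
      by (intro openin_diff openin_subtopology_self)
    show ?thesis by (rule o[folded eq])
  qed
  moreover have "continuous_on C (glue_map P Q G A)"
  proof -
    obtain x where x: "poly P x \<in> A" "C = connected_component_set (poly P -` A) x"
      using C by (auto simp: components_def)
    let ?\<mu> = "transport P A x (1/2)"
    have base: "transport P A y (1/2) = ?\<mu>" if "y \<in> C" for y
    proof (rule P.transport_unique[OF A(1-3)])
      have "connected_component (poly P -` A) x y" using that x(2) by simp
      from connected_component_trans[OF connected_component_sym[OF this] P.transport_component(1)[OF A(1-3) x(1) A(4)]]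
      show "connected_component (poly P -` A) y ?\<mu>" .
    qed (rule P.poly_transport[OF A(1-3) x(1) A(4)])
    have "continuous_on C (\<lambda>y. transport Q A (G ?\<mu>) (poly P y))"
    proof (rule continuous_on_compose2[of A _ C "poly P"])
      show "continuous_on A (transport Q A (G ?\<mu>))"
        by (rule Q.continuous_on_transport[OF A(1-3)]) (simp only: base_G[OF x(1)] A(4))
      show "poly P ` C \<subseteq> A" using in_components_subset[OF C] by auto
    qed (intro continuous_intros)
    then show ?thesis by (rule continuous_on_eq) (simp add: glue_map_def base)
  qed
  ultimately show "openin (top_of_set (poly P -` A)) C \<and> continuous_on C (glue_map P Q G A)" ..
qed

end

text \<open>
  The point \<open>2 c - 1/2\<close> is opposite to \<open>1/2\<close> on the circle around \<open>c\<close>: two sheets that meet over it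
  contain consecutive edges around a vertex over \<open>c\<close>.
\<close>

lemma glue_map_agree_at:
  assumes A: "A \<subseteq> - {0, 1}" "simply_connected A" "locally path_connected A"
    and B: "B \<subseteq> - {0, 1}" "simply_connected B" "locally path_connected B"
    and c: "c = 0 \<or> c = (1::real)"
    and kA: "\<And>t. 0 \<le> t \<Longrightarrow> t \<le> 1/2 \<Longrightarrow> complex_of_real c + (1/2 - complex_of_real c) * cis (2 * pi * t) \<in> A"
    and kB: "\<And>t. 1/2 \<le> t \<Longrightarrow> t \<le> 1 \<Longrightarrow> complex_of_real c + (1/2 - complex_of_real c) * cis (2 * pi * t) \<in> B"
    and x: "poly P x = 2 * c - 1/2"
  shows "glue_map P Q G A x = glue_map P Q G B x"
proof -
  define \<kappa> where "\<kappa> = (\<lambda>t. complex_of_real c + (1/2 - complex_of_real c) * cis (2 * pi * t))"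
  have \<kappa>: "continuous_on {0..1} \<kappa>" "\<kappa> ` {0..1/2} \<subseteq> A" "\<kappa> ` {1/2..1} \<subseteq> B"
    using kA kB by (auto simp: \<kappa>_def intro!: continuous_intros)
  have ends: "\<kappa> 0 = 1/2" "\<kappa> (1/2) = 2 * c - 1/2" "\<kappa> 1 = 1/2"
    by (simp_all add: \<kappa>_def)
  have mA: "1/2 \<in> A" and mB: "1/2 \<in> B" and xA: "2 * c - 1/2 \<in> A" and xB: "2 * c - 1/2 \<in> B"
    using kA[of 0] kA[of "1/2"] kB[of "1/2"] kB[of 1] ends by (simp_all add: \<kappa>_def)
  let ?\<mu> = "transport P A x (1/2)" and ?\<nu> = "transport P B x (1/2)"
  have P\<mu>: "poly P ?\<mu> = 1/2" and P\<nu>: "poly P ?\<nu> = 1/2"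
    using P.poly_transport[OF A] P.poly_transport[OF B] mA mB xA xB x by auto
  have turn_eq: "turn R c a b \<longleftrightarrow> (\<exists>\<gamma>. path \<gamma> \<and> pathstart \<gamma> = a \<and> pathfinish \<gamma> = b \<and>
      (\<forall>t\<in>{0..1}. poly R (\<gamma> t) = \<kappa> t))" for R a b
    by (simp add: turn_def \<kappa>_def)
  have P\<mu>': "poly P ?\<mu> = \<kappa> 0" unfolding P\<mu> ends ..
  \<comment> \<open>The first half of the circle lifts inside \<open>A\<close> from
    \<open>?\<mu>\<close> to \<open>x\<close>, the second inside \<open>B\<close> from
    \<open>x\<close> to \<open>?\<nu>\<close>; so the full turn leads from \<open>?\<mu>\<close> to
    \<open>?\<nu>\<close>.\<close>
  have "transport P A ?\<mu> (2 * c - 1/2) = x"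
    by (rule P.transport_back[OF A]) (use x xA mA in auto)
  then have "turn P c ?\<mu> ?\<nu>"
    unfolding turn_eq P.lift_iff_transport[OF A B \<kappa> P\<mu>'] ends by simp
  then have tQ: "turn Q c (G ?\<mu>) (G ?\<nu>)" using turn_G c by auto
  have Q\<mu>: "poly Q (G ?\<mu>) = \<kappa> 0" unfolding G[OF P\<mu>] ends ..
  \<comment> \<open>The same turn in \<open>Q\<close>, with its second half undone, shows that the
    point over \<open>2 * c - 1/2\<close> is the same when reached from \<open>G ?\<mu>\<close> in
    \<open>A\<close> and from \<open>G ?\<nu>\<close> in \<open>B\<close>.\<close>
  have "G ?\<nu> = transport Q B (transport Q A (G ?\<mu>) (2 * c - 1/2)) (1/2)"
    using tQ unfolding turn_eq Q.lift_iff_transport[OF A B \<kappa> Q\<mu>] ends .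
  then have "transport Q B (G ?\<nu>) (2 * c - 1/2) = transport Q A (G ?\<mu>) (2 * c - 1/2)"
    using Q.transport_back[OF B, of "transport Q A (G ?\<mu>) (2 * c - 1/2)" "1/2" "2 * c - 1/2"]
      Q.poly_transport[OF A, of "G ?\<mu>" "2 * c - 1/2"] mA mB xA xB unfolding G[OF P\<mu>] by simp
  then show ?thesis by (simp add: glue_map_def x)
qed

lemma half_mem: "1/2 \<in> upper" "1/2 \<in> lower" by (auto simp: upper_def lower_def)

text \<open>Over an interval of the real axis both maps lift \<open>poly P\<close> through
  \<open>poly Q\<close>, so by unique lifting a single point per component suffices. At 1/2 both
  maps equal \<open>G\<close>; at -1/2 and 3/2, the points opposite to 1/2 on the circles around 0
  and 1, the cyclic orders apply.\<close>

lemma glue_map_agree: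
  assumes x: "poly P x \<in> upper" "poly P x \<in> lower"
  shows "glue_map P Q G upper x = glue_map P Q G lower x"
proof -
  have main: "glue_map P Q G upper x = glue_map P Q G lower x"
    if J: "convex J" "J \<subseteq> upper \<inter> lower" "poly P x \<in> J" "j \<in> J"
      and base: "\<And>y. poly P y = j \<Longrightarrow> glue_map P Q G upper y = glue_map P Q G lower y" for J j
  proof -
    have JS: "J \<subseteq> - {0, 1}" "simply_connected J" "locally path_connected J"
      using J upper_sheet by (auto simp: convex_imp_simply_connected convex_imp_locally_path_connected)
    let ?y = "transport P J x j"
    let ?K = "connected_component_set (poly P -` J) x"
    have K: "?K \<subseteq> poly P -` J" by (rule connected_component_subset)
    have K2: "?K \<subseteq> poly P -` upper" "?K \<subseteq> poly P -` lower" using K J(2) by auto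
    show ?thesis
    proof (rule covering_space_lift_unique[OF Q.covering,
          of "glue_map P Q G upper" ?y "glue_map P Q G lower" ?K "poly P"])
      show "glue_map P Q G upper ?y = glue_map P Q G lower ?y"
        using P.poly_transport[OF JS J(3,4)] by (rule base)
      show "continuous_on ?K (glue_map P Q G upper)"
        by (rule continuous_on_subset[OF continuous_on_glue_map[OF upper_sheet half_mem(1)] K2(1)])
      show "continuous_on ?K (glue_map P Q G lower)"
        by (rule continuous_on_subset[OF continuous_on_glue_map[OF lower_sheet half_mem(2)] K2(2)])
      show lift_U: "poly P y = poly Q (glue_map P Q G upper y)" if "y \<in> ?K" for y
        using poly_glue_map[OF upper_sheet half_mem(1), of y] that K2 by auto
      show lift_L: "poly P y = poly Q (glue_map P Q G lower y)" if "y \<in> ?K" for y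
        using poly_glue_map[OF lower_sheet half_mem(2), of y] that K2 by auto
      show PS: "poly P \<in> ?K \<rightarrow> - {0, 1}" using K JS(1) by blast
      show "glue_map P Q G upper \<in> ?K \<rightarrow> poly Q -` (- {0, 1})"
      proof
        fix y assume y: "y \<in> ?K"
        then have "poly P y \<in> - {0, 1}" by (rule PS[THEN funcset_mem])
        then show "glue_map P Q G upper y \<in> poly Q -` (- {0, 1})" unfolding lift_U[OF y] by simp
      qed
      show "glue_map P Q G lower \<in> ?K \<rightarrow> poly Q -` (- {0, 1})"
      proof
        fix y assume y: "y \<in> ?K"
        then have "poly P y \<in> - {0, 1}" by (rule PS[THEN funcset_mem])
        then show "glue_map P Q G lower y \<in> poly Q -` (- {0, 1})" unfolding lift_L[OF y] by simp
      qed
      show "?y \<in> ?K" using P.transport_component[OF JS J(3,4)] by simp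
      show "x \<in> ?K" using J(3) by simp
    qed (auto intro!: continuous_intros)
  qed
  \<comment> \<open>The circles start at 1/2, to the right of 0 but to the left of 1. Run through
    counterclockwise, the first begins in the upper half plane and the second in the lower one, so
    the two sheets swap roles for \<open>c = 1\<close>.\<close>
  have circ1: "complex_of_real c + (1/2 - complex_of_real c) * cis (2 * pi * t)
      \<in> (if c = 0 then upper else lower)" if "c = 0 \<or> c = 1" "0 \<le> t" "t \<le> 1/2" for c t :: real
    using half_circle[of c t] sin_first_half[of t] that by (auto simp: upper_def lower_def)
  have circ2: "complex_of_real c + (1/2 - complex_of_real c) * cis (2 * pi * t)
      \<in> (if c = 0 then lower else upper)" if "c = 0 \<or> c = 1" "1/2 \<le> t" "t \<le> 1" for c t :: real
    using half_circle[of c t] sin_second_half[of t] that by (auto simp: upper_def lower_def)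
  have im: "Im (poly P x) = 0" "poly P x \<noteq> 0" "poly P x \<noteq> 1"
    using x by (auto simp: upper_def lower_def)
  define u where "u = Re (poly P x)"
  have u: "poly P x = complex_of_real u" using im by (simp add: u_def complex_eq_iff)
  have "u \<noteq> 0" "u \<noteq> 1" using im u by auto
  then consider "u < 0" | "0 < u" "u < 1" | "1 < u" by linarith
  then show ?thesis
  proof cases
    case 1
    show ?thesis
    proof (rule main[of "complex_of_real ` {..<0}" "- 1/2"])
      show "convex (complex_of_real ` {..<0})"
        by (intro convex_linear_image) (auto simp: bounded_linear.linear bounded_linear_of_real)
      show "- 1/2 \<in> complex_of_real ` {..<0}" by (rule image_eqI[of _ _ "-1/2"]) auto
      fix y assume "poly P y = - 1/2"
      then show "glue_map P Q G upper y = glue_map P Q G lower y"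
        using circ1[of 0] circ2[of 0]
        by (intro glue_map_agree_at[OF upper_sheet lower_sheet, of 0]) simp_all
    qed (use u 1 in \<open>auto simp: upper_def lower_def\<close>)
  next
    case 2
    show ?thesis
    proof (rule main[of "complex_of_real ` {0<..<1}" "1/2"])
      show "convex (complex_of_real ` {0<..<1})"
        by (intro convex_linear_image) (auto simp: bounded_linear.linear bounded_linear_of_real)
      show "1/2 \<in> complex_of_real ` {0<..<1}" by (rule image_eqI[of _ _ "1/2"]) auto
      fix y assume y: "poly P y = 1/2"
      have Qs: "transport Q upper (G y) (1/2) = G y" "transport Q lower (G y) (1/2) = G y"
        by (rule Q.transport_refl[OF upper_sheet G[OF y] half_mem(1)]
            Q.transport_refl[OF lower_sheet G[OF y] half_mem(2)])+
      have Ps: "transport P upper y (1/2) = y" "transport P lower y (1/2) = y"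
        by (rule P.transport_refl[OF upper_sheet y half_mem(1)]
            P.transport_refl[OF lower_sheet y half_mem(2)])+
      show "glue_map P Q G upper y = glue_map P Q G lower y"
        by (simp only: glue_map_def Ps Qs y)
    qed (use u 2 in \<open>auto simp: upper_def lower_def\<close>)
  next
    case 3
    show ?thesis
    proof (rule main[of "complex_of_real ` {1<..}" "3/2"])
      show "convex (complex_of_real ` {1<..})"
        by (intro convex_linear_image) (auto simp: bounded_linear.linear bounded_linear_of_real)
      show "3/2 \<in> complex_of_real ` {1<..}" by (rule image_eqI[of _ _ "3/2"]) auto
      fix y assume "poly P y = 3/2"
      then show "glue_map P Q G upper y = glue_map P Q G lower y"
        using circ1[of 1] circ2[of 1]
        by (intro glue_map_agree_at[OF lower_sheet upper_sheet, of 1, symmetric]) simp_all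
    qed (use u 3 in \<open>auto simp: upper_def lower_def\<close>)
  qed
qed

lemma glued_map:
  obtains h where "continuous_on (poly P -` (- {0, 1})) h"
    "\<And>x. x \<in> poly P -` (- {0, 1}) \<Longrightarrow> poly Q (h x) = poly P x"
proof
  let ?X = "poly P -` (- {0, 1})"
  let ?h = "\<lambda>x. if Im (poly P x) \<le> 0 then glue_map P Q G lower x else glue_map P Q G upper x"
  have L: "{x \<in> ?X. Im (poly P x) \<le> 0} = poly P -` lower"
    and U: "{x \<in> ?X. 0 \<le> Im (poly P x)} = poly P -` upper"
    by (auto simp: lower_def upper_def)
  show "continuous_on ?X ?h"
  proof (rule continuous_on_cases_le)
    show "continuous_on {x \<in> ?X. Im (poly P x) \<le> 0} (glue_map P Q G lower)"
      unfolding L by (rule continuous_on_glue_map[OF lower_sheet half_mem(2)])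
    show "continuous_on {x \<in> ?X. 0 \<le> Im (poly P x)} (glue_map P Q G upper)"
      unfolding U by (rule continuous_on_glue_map[OF upper_sheet half_mem(1)])
    show "glue_map P Q G lower x = glue_map P Q G upper x" if "x \<in> ?X" "Im (poly P x) = 0" for x
      using glue_map_agree[of x] that by (auto simp: lower_def upper_def)
  qed (intro continuous_intros)
  show "poly Q (?h x) = poly P x" if "x \<in> ?X" for x
    using poly_glue_map[OF lower_sheet half_mem(2), of x]
      poly_glue_map[OF upper_sheet half_mem(1), of x] that by (auto simp: lower_def upper_def)
qed

end

section \<open>Removable singularities and polynomiality of the lift\<close>

lemma holomorphic_extend_finite:
  fixes f :: "complex \<Rightarrow> complex"
  assumes "finite K" "f holomorphic_on -K"
    and "\<And>r. \<exists>B. \<forall>z\<in>ball 0 r - K. norm (f z) \<le> B"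
  shows "\<exists>g. g holomorphic_on UNIV \<and> (\<forall>z\<in>-K. g z = f z)"
  using assms
proof (induction K arbitrary: f rule: finite_induct)
  case empty
  then show ?case by auto
next
  case (insert x K)
  have oK: "open (- K)" using insert.hyps by (simp add: finite_imp_closed open_Compl)
  have eq: "- insert x K = (- K) - {x}" by auto
  have "\<exists>B. eventually (\<lambda>z. norm (f z) \<le> B) (at x)"
  proof -
    obtain B where B: "\<And>z. z \<in> ball 0 (norm x + 1) - insert x K \<Longrightarrow> norm (f z) \<le> B"
      using insert.prems(2) by meson
    have "open (ball 0 (norm x + 1) \<inter> - K)" using oK by auto
    moreover have "x \<in> ball 0 (norm x + 1) \<inter> - K" using insert.hyps by auto
    ultimately show ?thesis
      unfolding eventually_at_topological using B by (intro exI[of _ B]) blast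
  qed
  moreover have "x \<in> interior (- K)" using oK insert.hyps by (simp add: interior_open)
  moreover have "f holomorphic_on (- K) - {x}" using insert.prems(1) eq by simp
  ultimately obtain g where g: "g holomorphic_on - K" "\<And>z. z \<in> - K - {x} \<Longrightarrow> g z = f z"
    using holomorphic_on_extend_bounded[of f "- K" x] by blast
  \<comment> \<open>Filling one puncture adds a single value, so boundedness on every ball passes on
    to the extension and the induction can continue.\<close>
  have "\<exists>B. \<forall>z\<in>ball 0 r - K. norm (g z) \<le> B" for r
  proof -
    obtain B where B: "\<And>z. z \<in> ball 0 r - insert x K \<Longrightarrow> norm (f z) \<le> B"
      using insert.prems(2) by meson
    have "norm (g z) \<le> max B (norm (g x))" if "z \<in> ball 0 r - K" for z
      using B[of z] g(2)[of z] that by (cases "z = x") auto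
    then show ?thesis by blast
  qed
  from insert.IH[OF g(1) this] obtain h where "h holomorphic_on UNIV" "\<And>z. z \<in> - K \<Longrightarrow> h z = g z"
    by blast
  then show ?case using g(2) by (intro exI[of _ h]) auto
qed

lemma poly_bounded_preimage:
  fixes Q :: "complex poly"
  assumes "degree Q > 0"
  obtains R where "\<And>y. norm (poly Q y) \<le> B \<Longrightarrow> norm y \<le> R"
proof -
  obtain a q where q: "Q = pCons a q" by (cases Q)
  then have "q \<noteq> 0" using assms by auto
  from poly_infinity[OF this, of "B + 1" a] obtain r where
    "\<forall>z. r \<le> norm z \<longrightarrow> B + 1 \<le> norm (poly Q z)" unfolding q by auto
  then have "norm y \<le> r" if "norm (poly Q y) \<le> B" for y
    using that by (smt (verit))
  then show thesis by (rule that)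
qed

lemma poly_bounded_ball:
  fixes P :: "complex poly"
  obtains B where "\<And>z. norm z \<le> r \<Longrightarrow> norm (poly P z) \<le> B"
proof -
  have "compact (poly P ` cball 0 r)"
    by (intro compact_continuous_image continuous_intros compact_cball)
  then obtain B where "\<And>w. w \<in> poly P ` cball 0 r \<Longrightarrow> norm w \<le> B"
    using compact_imp_bounded bounded_iff by metis
  then show thesis using that[of B] by auto
qed

text \<open>Wherever \<open>g\<close> is bounded, so is \<open>poly P\<close>, and then the argument
  is bounded since \<open>P\<close> is proper. Hence \<open>g\<close> tends to infinity at infinity,
  and an entire function with a pole there is a polynomial.\<close>

lemma entire_lift_polynomial:
  fixes P Q :: "complex poly"
  assumes degP: "degree P > 0"
    and g: "g holomorphic_on UNIV" and lift: "\<And>z. poly Q (g z) = poly P z"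
  obtains p where "P = pcompose Q p"
proof -
  have "filterlim g at_infinity at_infinity"
    unfolding filterlim_at_infinity[OF order_refl]
  proof (intro allI impI)
    fix r :: real
    obtain B where B: "\<And>z. norm z \<le> r \<Longrightarrow> norm (poly Q z) \<le> B" using poly_bounded_ball by blast
    obtain R where R: "\<And>y. norm (poly P y) \<le> B \<Longrightarrow> norm y \<le> R"
      using poly_bounded_preimage[OF degP] by blast
    have "r \<le> norm (g z)" if "R + 1 \<le> norm z" for z
    proof (rule ccontr)
      assume "\<not> r \<le> norm (g z)"
      then have "norm (poly P z) \<le> B" using B[of "g z"] lift by simp
      then show False using R[of z] that by simp
    qed
    then show "\<forall>\<^sub>F x in at_infinity. r \<le> norm (g x)"
      unfolding eventually_at_infinity by blast
  qed
  then have "((\<lambda>z. inverse (g z)) \<longlongrightarrow> 0) at_infinity"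
    by (rule filterlim_compose[OF tendsto_inverse_0])
  then obtain a n where a: "\<And>z. g z = (\<Sum>i\<le>n. a i * z^i)"
    using pole_at_infinity[OF g, of 0] by (auto simp: o_def)
  have "poly (\<Sum>i\<le>n. monom (a i) i) z = g z" for z
    by (simp add: poly_sum poly_monom a)
  then have "poly P = poly (pcompose Q (\<Sum>i\<le>n. monom (a i) i))"
    using lift by (auto simp: poly_pcompose)
  then show thesis using that by (simp add: poly_eq_poly_eq_iff)
qed

text \<open>Continuity keeps \<open>h\<close> locally within a disk on which \<open>poly Q\<close>
  is injective, and there \<open>h\<close> is the holomorphic inverse branch applied to
  \<open>f\<close>.\<close>

lemma lift_holomorphic:
  fixes Q :: "complex poly"
  assumes "open X" and h: "continuous_on X h" and f: "f holomorphic_on X"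
    and lift: "\<And>x. x \<in> X \<Longrightarrow> poly Q (h x) = f x"
    and reg: "\<And>x. x \<in> X \<Longrightarrow> poly (pderiv Q) (h x) \<noteq> 0"
  shows "h holomorphic_on X"
  unfolding holomorphic_on_def
proof
  fix x assume x: "x \<in> X"
  obtain e where e: "e > 0" "inj_on (poly Q) (ball (h x) e)"
    using poly_locally_injective[OF reg[OF x]] by blast
  obtain g where g: "g holomorphic_on (poly Q ` ball (h x) e)"
      "\<And>z. z \<in> ball (h x) e \<Longrightarrow> deriv (poly Q) z * deriv g (poly Q z) = 1"
      "\<And>z. z \<in> ball (h x) e \<Longrightarrow> g (poly Q z) = z"
    by (rule holomorphic_has_inverse[OF holomorphic_on_poly open_ball e(2)]) (rule that)
  define N where "N = X \<inter> h -` ball (h x) e"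
  have oN: "open N" unfolding N_def by (rule continuous_open_preimage[OF h \<open>open X\<close> open_ball])
  have xN: "x \<in> N" using x e by (simp add: N_def)
  have "(g \<circ> f) holomorphic_on N"
  proof (rule holomorphic_on_compose_gen[OF _ g(1)])
    show "f holomorphic_on N" using f by (rule holomorphic_on_subset) (auto simp: N_def)
    show "f ` N \<subseteq> poly Q ` ball (h x) e"
    proof (rule image_subsetI)
      fix y assume "y \<in> N"
      then have "f y = poly Q (h y)" "h y \<in> ball (h x) e" using lift[of y] by (simp_all add: N_def)
      then show "f y \<in> poly Q ` ball (h x) e" by simp
    qed
  qed
  moreover have "(g \<circ> f) y = h y" if "y \<in> N" for y
  proof -
    have "f y = poly Q (h y)" "h y \<in> ball (h x) e" using lift[of y] that by (simp_all add: N_def)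
    then show ?thesis using g(3)[of "h y"] by simp
  qed
  ultimately have "h holomorphic_on N" by (rule holomorphic_transform)
  then have "h field_differentiable at x"
    using oN xN by (rule holomorphic_on_imp_differentiable_at)
  then show "h field_differentiable at x within X"
    by (rule field_differentiable_at_within)
qed

context regular_poly_pair
begin

text \<open>The glued lift is holomorphic off the finite fibres over 0 and 1. It is bounded on balls
  because \<open>poly P\<close> is and \<open>Q\<close> is proper, so it extends; the lifting
  equation extends with it because the complement of a finite set is dense.\<close>

lemma poly_factors_through: "\<exists>p. P = pcompose Q p"
proof -
  let ?X = "poly P -` (- {0, 1})"
  obtain h where h: "continuous_on ?X h" "\<And>x. x \<in> ?X \<Longrightarrow> poly Q (h x) = poly P x"
    using glued_map by blast
  define K where "K = poly P -` {0, 1}"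
  have X: "?X = - K" by (auto simp: K_def)
  have "K = {z. poly P z = 0} \<union> {z. poly P z = 1}" by (auto simp: K_def)
  then have finK: "finite K" using finite_poly_fibre[OF P.degree_pos] by simp
  then have oX: "open ?X" unfolding X by (simp add: finite_imp_closed open_Compl)
  have "h holomorphic_on ?X"
  proof (rule lift_holomorphic[OF oX h(1) holomorphic_on_poly h(2)])
    fix x assume "x \<in> ?X"
    then show "poly (pderiv Q) (h x) \<noteq> 0" using h(2)[of x] by (intro Q.regular) auto
  qed
  then have holh: "h holomorphic_on - K" unfolding X .
  have "\<exists>B. \<forall>z\<in>ball 0 r - K. norm (h z) \<le> B" for r
  proof -
    obtain B where B: "\<And>z. norm z \<le> r \<Longrightarrow> norm (poly P z) \<le> B" using poly_bounded_ball by blast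
    obtain R where R: "\<And>y. norm (poly Q y) \<le> B \<Longrightarrow> norm y \<le> R"
      using poly_bounded_preimage[OF Q.degree_pos] by blast
    show ?thesis using B R h(2) X by (intro exI[of _ R]) auto
  qed
  from holomorphic_extend_finite[OF finK holh this] obtain g
    where g: "g holomorphic_on UNIV" "\<And>z. z \<in> - K \<Longrightarrow> g z = h z" by blast
  have contg: "continuous_on UNIV g" using g(1) by (rule holomorphic_on_imp_continuous_on)
  have "closed {z. poly Q (g z) = poly P z}"
    by (intro closed_Collect_eq continuous_intros contg)
  moreover have "- K \<subseteq> {z. poly Q (g z) = poly P z}" using g(2) h(2) X by auto
  ultimately have "closure (- K) \<subseteq> {z. poly Q (g z) = poly P z}" by (rule closure_minimal[rotated])
  moreover have "closure (- K) = UNIV"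
    using finK by (simp add: closure_complement empty_interior_finite)
  ultimately have "poly Q (g z) = poly P z" for z by auto
  from entire_lift_polynomial[OF P.degree_pos g(1) this] show ?thesis by blast
qed

end

section \<open>Rigidity of Shabat polynomials\<close>

definition tree_iso_by ::
  "('v \<Rightarrow> 'w) \<Rightarrow> ('e \<Rightarrow> 'f) \<Rightarrow> ('v, 'e) bicolored_tree \<Rightarrow> ('w, 'f) bicolored_tree \<Rightarrow> bool" where
  "tree_iso_by f g T U \<longleftrightarrow>
     bij_betw f (black T \<union> white T) (black U \<union> white U) \<and>
     f ` black T = black U \<and> f ` white T = white U \<and>
     bij_betw g (edges T) (edges U) \<and>
     (\<forall>v\<in>black T \<union> white T. \<forall>e\<in>edges T. incident T v e \<longleftrightarrow> incident U (f v) (g e)) \<and>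
     (\<forall>e\<in>edges T. \<forall>e'\<in>edges T. black_next T e e' \<longleftrightarrow> black_next U (g e) (g e')) \<and>
     (\<forall>e\<in>edges T. \<forall>e'\<in>edges T. white_next T e e' \<longleftrightarrow> white_next U (g e) (g e'))"

lemma tree_iso_iff: "tree_iso T U \<longleftrightarrow> (\<exists>f g. tree_iso_by f g T U)"
  by (simp add: tree_iso_def tree_iso_by_def)

lemma tree_iso_byD:
  assumes "tree_iso_by f g T U"
  shows "bij_betw f (black T \<union> white T) (black U \<union> white U)"
    "f ` black T = black U" "f ` white T = white U" "bij_betw g (edges T) (edges U)"
    "\<And>v e. v \<in> black T \<union> white T \<Longrightarrow> e \<in> edges T \<Longrightarrow> incident T v e \<longleftrightarrow> incident U (f v) (g e)"
    "\<And>e e'. e \<in> edges T \<Longrightarrow> e' \<in> edges T \<Longrightarrow> black_next T e e' \<longleftrightarrow> black_next U (g e) (g e')"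
    "\<And>e e'. e \<in> edges T \<Longrightarrow> e' \<in> edges T \<Longrightarrow> white_next T e e' \<longleftrightarrow> white_next U (g e) (g e')"
  using assms unfolding tree_iso_by_def by auto

lemma tree_iso_sym:
  assumes "tree_iso T U"
  shows "tree_iso U T"
proof -
  from assms obtain f g where "tree_iso_by f g T U" unfolding tree_iso_iff by blast
  note iso = tree_iso_byD[OF this]
  note f = iso(1-3) and g = iso(4) and inc = iso(5) and bn = iso(6) and wn = iso(7)
  define f' where "f' = inv_into (black T \<union> white T) f"
  define g' where "g' = inv_into (edges T) g"
  have f'f: "f' (f v) = v" if "v \<in> black T \<union> white T" for v
    using bij_betw_inv_into_left[OF f(1) that] by (simp add: f'_def)
  have ff': "f (f' v) = v" "f' v \<in> black T \<union> white T" if "v \<in> black U \<union> white U" for v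
    using bij_betw_inv_into_right[OF f(1) that] bij_betw_inv_into[OF f(1)] that
    by (auto simp: f'_def bij_betw_def)
  have gg': "g (g' e) = e" "g' e \<in> edges T" if "e \<in> edges U" for e
    using bij_betw_inv_into_right[OF g that] bij_betw_inv_into[OF g] that
    by (auto simp: g'_def bij_betw_def)
  have "bij_betw f' (black U \<union> white U) (black T \<union> white T)" "bij_betw g' (edges U) (edges T)"
    using bij_betw_inv_into[OF f(1)] bij_betw_inv_into[OF g] by (simp_all add: f'_def g'_def)
  moreover have "f' ` black U = black T" "f' ` white U = white T"
    unfolding f(2,3)[symmetric] image_image using f'f by auto
  moreover have "incident U v e \<longleftrightarrow> incident T (f' v) (g' e)"
    if "v \<in> black U \<union> white U" "e \<in> edges U" for v e
    using inc[OF ff'(2)[OF that(1)] gg'(2)[OF that(2)]] ff'(1)[OF that(1)] gg'(1)[OF that(2)] by simp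
  moreover have "black_next U e e' \<longleftrightarrow> black_next T (g' e) (g' e')"
      "white_next U e e' \<longleftrightarrow> white_next T (g' e) (g' e')"
    if "e \<in> edges U" "e' \<in> edges U" for e e'
    using bn[OF gg'(2)[OF that(1)] gg'(2)[OF that(2)]] wn[OF gg'(2)[OF that(1)] gg'(2)[OF that(2)]]
      gg'(1)[OF that(1)] gg'(1)[OF that(2)] by simp_all
  ultimately show ?thesis
    unfolding tree_iso_iff tree_iso_by_def by (intro exI[of _ f'] exI[of _ g'] conjI ballI) simp_all
qed

lemma tree_iso_trans:
  assumes "tree_iso T U" "tree_iso U V"
  shows "tree_iso T V"
proof -
  from assms(1) obtain f g where "tree_iso_by f g T U" unfolding tree_iso_iff by blast
  note iso = tree_iso_byD[OF this]
  note f = iso(1-3) and g = iso(4) and inc = iso(5) and bn = iso(6) and wn = iso(7)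
  from assms(2) obtain f' g' where "tree_iso_by f' g' U V" unfolding tree_iso_iff by blast
  note iso = tree_iso_byD[OF this]
  note f' = iso(1-3) and g' = iso(4) and inc' = iso(5) and bn' = iso(6) and wn' = iso(7)
  have fU: "f v \<in> black U \<union> white U" if "v \<in> black T \<union> white T" for v
    using bij_betwE[OF f(1)] that by blast
  have gU: "g e \<in> edges U" if "e \<in> edges T" for e using bij_betwE[OF g] that by blast
  show ?thesis
    unfolding tree_iso_def
  proof (intro exI[of _ "f' \<circ> f"] exI[of _ "g' \<circ> g"] conjI ballI)
    show "bij_betw (f' \<circ> f) (black T \<union> white T) (black V \<union> white V)" by (rule bij_betw_trans[OF f(1) f'(1)])
    show "bij_betw (g' \<circ> g) (edges T) (edges V)" by (rule bij_betw_trans[OF g g'])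
    show "(f' \<circ> f) ` black T = black V" "(f' \<circ> f) ` white T = white V"
      by (simp_all only: image_comp[symmetric] f f')
  next
    fix v e assume "v \<in> black T \<union> white T" "e \<in> edges T"
    then show "incident T v e \<longleftrightarrow> incident V ((f' \<circ> f) v) ((g' \<circ> g) e)"
      using inc inc' fU gU by simp
  next
    fix e e' assume "e \<in> edges T" "e' \<in> edges T"
    then show "black_next T e e' \<longleftrightarrow> black_next V ((g' \<circ> g) e) ((g' \<circ> g) e')"
      "white_next T e e' \<longleftrightarrow> white_next V ((g' \<circ> g) e) ((g' \<circ> g) e')"
      using bn bn' wn wn' gU by simp_all
  qed
qed

section \<open>Affine equivalence and its effect on trees\<close>

lemma shabat_equiv_iff_poly:
  "shabat_equiv P c11 c12 Q c21 c22 \<longleftrightarrow>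
     (\<exists>A a B b. A \<noteq> 0 \<and> a \<noteq> 0 \<and> (\<forall>z. poly Q z = A * poly P (a * z + b) + B) \<and>
        c21 = A * c11 + B \<and> c22 = A * c12 + B)"
proof -
  have "Q = smult A (pcompose P [:b, a:]) + [:B:] \<longleftrightarrow> (\<forall>z. poly Q z = A * poly P (a * z + b) + B)"
    for A B a b
    by (subst poly_eq_poly_eq_iff[symmetric]) (auto simp: fun_eq_iff poly_pcompose algebra_simps)
  then show ?thesis by (simp add: shabat_equiv_def)
qed

lemma shabat_equiv_sym:
  assumes "shabat_equiv P c11 c12 Q c21 c22"
  shows "shabat_equiv Q c21 c22 P c11 c12"
proof -
  from assms obtain A a B b where *: "A \<noteq> 0" "a \<noteq> 0" "\<And>z. poly Q z = A * poly P (a * z + b) + B"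
      "c21 = A * c11 + B" "c22 = A * c12 + B"
    unfolding shabat_equiv_iff_poly by blast
  have "poly P z = (1/A) * poly Q ((1/a) * z + (- b/a)) + (- B/A)" for z
    using * by (simp add: field_simps)
  moreover have "c11 = (1/A) * c21 + (- B/A)" "c12 = (1/A) * c22 + (- B/A)"
    using * by (simp_all add: field_simps)
  moreover have "1/A \<noteq> 0" "1/a \<noteq> 0" using * by simp_all
  ultimately show ?thesis unfolding shabat_equiv_iff_poly by blast
qed

lemma shabat_equiv_trans:
  assumes "shabat_equiv P c1 c2 Q d1 d2" "shabat_equiv Q d1 d2 R e1 e2"
  shows "shabat_equiv P c1 c2 R e1 e2"
proof -
  from assms(1) obtain A a B b where 1: "A \<noteq> 0" "a \<noteq> 0" "\<And>z. poly Q z = A * poly P (a * z + b) + B"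
      "d1 = A * c1 + B" "d2 = A * c2 + B"
    unfolding shabat_equiv_iff_poly by blast
  from assms(2) obtain A' a' B' b' where 2: "A' \<noteq> 0" "a' \<noteq> 0" "\<And>z. poly R z = A' * poly Q (a' * z + b') + B'"
      "e1 = A' * d1 + B'" "e2 = A' * d2 + B'"
    unfolding shabat_equiv_iff_poly by blast
  have "poly R z = (A' * A) * poly P ((a * a') * z + (a * b' + b)) + (A' * B + B')" for z
    using 1 2 by (simp add: algebra_simps)
  moreover have "e1 = (A' * A) * c1 + (A' * B + B')" "e2 = (A' * A) * c2 + (A' * B + B')"
    using 1 2 by (simp_all add: algebra_simps)
  moreover have "A' * A \<noteq> 0" "a * a' \<noteq> 0" using 1 2 by simp_all
  ultimately show ?thesis unfolding shabat_equiv_iff_poly by blast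
qed

lemma degree_add_const: "degree (P + [:w:]) = degree P"
  for P :: "'a::ab_group_add poly"
proof -
  have "P + [:w:] = P - [:- w:]" by (simp add: diff_conv_add_uminus del: add_uminus_conv_diff)
  then show ?thesis by (simp only: degree_diff_const)
qed

lemma shabat_equiv_shabat:
  assumes "shabat_equiv P c1 c2 Q d1 d2" "shabat P c1 c2"
  shows "shabat Q d1 d2"
proof -
  from assms(1) obtain A a B b where *: "A \<noteq> 0" "a \<noteq> 0" "Q = smult A (pcompose P [:b, a:]) + [:B:]"
      "d1 = A * c1 + B" "d2 = A * c2 + B"
    unfolding shabat_equiv_def by blast
  have "degree Q = degree P" using * by (simp add: degree_add_const degree_pcompose)
  moreover have "poly Q z \<in> {d1, d2}" if "poly (pderiv Q) z = 0" for z
  proof -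
    have "poly (pderiv P) (a * z + b) = 0"
      using that * by (simp add: pderiv_add pderiv_smult pderiv_pcompose poly_pcompose pderiv_pCons algebra_simps)
    then have "poly P (a * z + b) \<in> {c1, c2}" using assms(2) by (auto simp: shabat_def)
    then show ?thesis using * by (auto simp: poly_pcompose algebra_simps)
  qed
  moreover have "d1 \<noteq> d2" using * assms(2) by (simp add: shabat_def)
  ultimately show ?thesis using assms(2) by (auto simp: shabat_def)
qed

lemma connected_component_set_bij_image:
  assumes "continuous_on UNIV T" "continuous_on UNIV T'" "\<And>x. T' (T x) = x" "\<And>y. T (T' y) = y"
  shows "connected_component_set (T ` S) (T x) = T ` connected_component_set S x"
proof -
  have sub: "F ` connected_component_set X y \<subseteq> connected_component_set (F ` X) (F y)"
    if F: "continuous_on UNIV F" for F :: "'c::topological_space \<Rightarrow> 'd::topological_space" and X y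
  proof (cases "y \<in> X")
    case True
    show ?thesis
    proof (rule connected_component_maximal)
      show "connected (F ` connected_component_set X y)"
        by (intro connected_continuous_image continuous_on_subset[OF F]) auto
      show "F y \<in> F ` connected_component_set X y" using True by simp
      show "F ` connected_component_set X y \<subseteq> F ` X"
        by (intro image_mono connected_component_subset)
    qed
  next
    case False
    then show ?thesis by (simp add: connected_component_eq_empty[THEN iffD2])
  qed
  have "T ` T' ` connected_component_set (T ` S) (T x) \<subseteq> T ` connected_component_set (T' ` T ` S) (T' (T x))"
    by (intro image_mono sub assms(2))
  then have "connected_component_set (T ` S) (T x) \<subseteq> T ` connected_component_set S x"
    by (simp add: image_image assms(3,4))
  with sub[OF assms(1)] show ?thesis by (intro equalityI)
qed

text \<open>A complex affine map of the values sends the circle about \<open>c\<close> from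
  \<open>m\<close> to the circle about the image of \<open>c\<close>, with the same orientation and
  parametrization, so a lift is carried over by the substitution in the argument. The converse comes
  from the inverse substitution.\<close>

lemma lift_turn_affine:
  assumes PQ: "\<And>z. poly Q z = A * poly P (a * z + b) + B" and "A \<noteq> 0"
    and "lift_turn Q (A * c + B) (A * m + B) e e'"
  shows "lift_turn P c m ((\<lambda>z. a * z + b) ` e) ((\<lambda>z. a * z + b) ` e')"
proof -
  from assms(3) obtain \<gamma> where \<gamma>: "path \<gamma>" "pathstart \<gamma> \<in> e" "pathfinish \<gamma> \<in> e'"
    "\<And>t. t \<in> {0..1} \<Longrightarrow> poly Q (\<gamma> t) = A * c + B + (A * m + B - (A * c + B)) * cis (2 * pi * t)"
    by (auto simp: lift_turn_def)
  let ?\<delta> = "\<lambda>t. a * \<gamma> t + b"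
  have "poly P (?\<delta> t) = c + (m - c) * cis (2 * pi * t)" if "t \<in> {0..1}" for t
  proof -
    have "A * poly P (?\<delta> t) = A * (c + (m - c) * cis (2 * pi * t))"
      using \<gamma>(4)[OF that] PQ[of "\<gamma> t"] by (simp add: algebra_simps)
    then show ?thesis using \<open>A \<noteq> 0\<close> by simp
  qed
  moreover have "path ?\<delta>" using \<gamma>(1) by (auto simp: path_def intro!: continuous_intros)
  ultimately show ?thesis
    unfolding lift_turn_def using \<gamma>(2,3)
    by (intro exI[of _ ?\<delta>]) (auto simp: pathstart_def pathfinish_def)
qed

lemma in_open_segment_affine:
  fixes A :: complex
  assumes "A \<noteq> 0"
  shows "A * x + B \<in> open_segment (A * c + B) (A * d + B) \<longleftrightarrow> x \<in> open_segment c d"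
proof -
  have "A * x + B = (1 - u) *\<^sub>R (A * c + B) + u *\<^sub>R (A * d + B) \<longleftrightarrow> x = (1 - u) *\<^sub>R c + u *\<^sub>R d" for u
  proof -
    have "(1 - u) *\<^sub>R (A * c + B) + u *\<^sub>R (A * d + B) = A * ((1 - u) *\<^sub>R c + u *\<^sub>R d) + B"
      by (simp add: scaleR_conv_of_real algebra_simps)
    then show ?thesis using assms by simp
  qed
  then show ?thesis using assms by (simp add: in_segment)
qed

text \<open>As \<open>Q\<close> is \<open>P\<close> after \<open>z \<mapsto> a * z + b\<close>, up
  to an affine change of values, this substitution carries the tree of \<open>Q\<close> onto the
  tree of \<open>P\<close>. It preserves all the plane structure because it preserves
  orientation.\<close>

lemma shabat_equiv_imp_tree_iso:
  assumes "shabat_equiv P c11 c12 Q c21 c22"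
  shows "tree_iso (shabat_tree Q c21 c22) (shabat_tree P c11 c12)"
proof -
  from assms obtain A a B b where A: "A \<noteq> 0" and a: "a \<noteq> 0"
    and PQ: "\<And>z. poly Q z = A * poly P (a * z + b) + B"
    and c: "c21 = A * c11 + B" "c22 = A * c12 + B"
    unfolding shabat_equiv_iff_poly by blast
  define T where "T = (\<lambda>z. a * z + b)"
  define T' where "T' = (\<lambda>z. (1/a) * z + (- b/a))"
  have T'T: "T' (T z) = z" and TT': "T (T' z) = z" for z
    using a by (simp_all add: T_def T'_def field_simps)
  have cont: "continuous_on S T" "continuous_on S T'" for S
    using a by (auto simp: T_def T'_def intro!: continuous_intros)
  have QP: "poly P z = (1/A) * poly Q (T' z) + (- B/A)" for z
    using A PQ[of "T' z"] TT'[of z] by (simp add: T_def field_simps)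
  have PQ': "poly Q z = A * poly P (T z) + B" for z using PQ by (simp add: T_def)
  have injT: "inj T" using T'T by (metis injI)
  have imT: "T ` {z. R (T z)} = {z. R z}" for R
    using TT' by (auto simp: image_iff) metis
  let ?EQ = "{z. poly Q z \<in> open_segment c21 c22}" and ?EP = "{z. poly P z \<in> open_segment c11 c12}"
  have E: "T ` ?EQ = ?EP"
    using imT[of "\<lambda>z. poly P z \<in> open_segment c11 c12"] by (simp add: PQ' c in_open_segment_affine[OF A])
  have b1: "T ` {z. poly Q z = c21} = {z. poly P z = c11}" and w1: "T ` {z. poly Q z = c22} = {z. poly P z = c12}"
    using imT[of "\<lambda>z. poly P z = c11"] imT[of "\<lambda>z. poly P z = c12"] A by (simp_all add: PQ' c)
  have comp: "(`) T ` components ?EQ = components ?EP"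
    unfolding components_def E[symmetric] image_image
    by (simp add: connected_component_set_bij_image[OF cont T'T TT'])
  have clos: "T v \<in> closure (T ` e) \<longleftrightarrow> v \<in> closure e" for v e
  proof
    assume "v \<in> closure e"
    then show "T v \<in> closure (T ` e)"
      using image_closure_subset[of e T "closure (T ` e)"] cont closure_subset[of "T ` e"] by auto
  next
    assume "T v \<in> closure (T ` e)"
    moreover have "T' ` T ` e \<subseteq> closure e" using T'T closure_subset by (auto simp: image_image)
    ultimately have "T' (T v) \<in> closure e"
      using image_closure_subset[of "T ` e" T' "closure e"] cont by auto
    then show "v \<in> closure e" by (simp add: T'T)
  qed
  have turn: "lift_turn Q (A * c + B) (A * m + B) e e' \<longleftrightarrow> lift_turn P c m (T ` e) (T ` e')" for c m e e'
  proof
    assume "lift_turn Q (A * c + B) (A * m + B) e e'"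
    then show "lift_turn P c m (T ` e) (T ` e')"
      unfolding T_def by (rule lift_turn_affine[OF PQ A])
  next
    assume "lift_turn P c m (T ` e) (T ` e')"
    moreover have "(1/A) * (A * c + B) + (- B/A) = c" "(1/A) * (A * m + B) + (- B/A) = m"
      using A by (simp_all add: field_simps)
    ultimately have "lift_turn P ((1/A) * (A * c + B) + (- B/A)) ((1/A) * (A * m + B) + (- B/A)) (T ` e) (T ` e')"
      by simp
    then have "lift_turn Q (A * c + B) (A * m + B) (T' ` T ` e) (T' ` T ` e')"
      unfolding T'_def by (rule lift_turn_affine[rotated 2]) (use QP A in \<open>auto simp: T'_def\<close>)
    then show "lift_turn Q (A * c + B) (A * m + B) e e'" by (simp add: image_image T'T)
  qed
  have mid: "midpoint (A * c11 + B) (A * c12 + B) = A * midpoint c11 c12 + B"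
    by (simp add: midpoint_def scaleR_conv_of_real algebra_simps)
  show ?thesis
    unfolding tree_iso_def shabat_tree_def bicolored_tree.simps
  proof (intro exI[of _ T] exI[of _ "(`) T"] conjI ballI)
    show "bij_betw T ({z. poly Q z = c21} \<union> {z. poly Q z = c22}) ({z. poly P z = c11} \<union> {z. poly P z = c12})"
      using injT b1 w1 by (auto simp: bij_betw_def image_Un intro: inj_on_subset)
    show "bij_betw ((`) T) (components ?EQ) (components ?EP)"
      using comp injT by (auto simp: bij_betw_def inj_on_def inj_image_eq_iff)
  qed (use b1 w1 clos turn in \<open>simp_all add: mid c\<close>)
qed

section \<open>From isomorphic trees back to equivalent polynomials\<close>

lemma shabat_regular_poly:
  assumes "shabat P c1 c2"
  shows "regular_poly P (- {c1, c2})"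
proof
  show "degree P > 0" using assms by (simp add: shabat_def)
  show "open (- {c1, c2})" by (intro open_Compl finite_imp_closed) simp
  show "poly (pderiv P) z \<noteq> 0" if "poly P z \<in> - {c1, c2}" for z
    using assms that unfolding shabat_def by blast
qed

lemma open_segment_sheet:
  fixes c1 c2 :: complex
  shows "open_segment c1 c2 \<subseteq> - {c1, c2}" "simply_connected (open_segment c1 c2)"
    "locally path_connected (open_segment c1 c2)"
proof -
  show "open_segment c1 c2 \<subseteq> - {c1, c2}" by (auto simp: open_segment_def)
qed (simp_all add: convex_imp_simply_connected convex_imp_locally_path_connected)

lemma card_edges_shabat_tree:
  assumes "shabat P c1 c2"
  shows "card (edges (shabat_tree P c1 c2)) = degree P" "finite (edges (shabat_tree P c1 c2))"
proof -
  interpret regular_poly P "- {c1, c2}" using assms by (rule shabat_regular_poly)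
  have ne: "open_segment c1 c2 \<noteq> {}" using assms by (simp add: shabat_def)
  have "edges (shabat_tree P c1 c2) = components (poly P -` open_segment c1 c2)"
    by (simp add: shabat_tree_def vimage_def)
  then show card: "card (edges (shabat_tree P c1 c2)) = degree P"
    using card_components_vimage[OF open_segment_sheet ne] by simp
  then show "finite (edges (shabat_tree P c1 c2))"
    using degree_pos by (metis card.infinite less_irrefl)
qed

text \<open>The edge bijection induces a map of the points over 1/2 to which the gluing applies,
  giving \<open>P = pcompose Q p\<close>. Equal numbers of edges mean equal degrees, which makes
  \<open>p\<close> linear.\<close>

lemma rigidity_normalized:
  assumes P: "shabat P 0 1" and Q: "shabat Q 0 1"
    and iso: "tree_iso (shabat_tree P 0 1) (shabat_tree Q 0 1)"
  shows "shabat_equiv Q 0 1 P 0 1"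
proof -
  interpret P: regular_poly P "- {0, 1}" using P by (rule shabat_regular_poly)
  interpret Q: regular_poly Q "- {0, 1}" using Q by (rule shabat_regular_poly)
  let ?I = "open_segment 0 (1::complex)"
  let ?EP = "components (poly P -` ?I)" and ?EQ = "components (poly Q -` ?I)"
  have half: "1/2 \<in> ?I"
    using midpoint_in_open_segment[of 0 "1::complex"] by (simp add: midpoint_def scaleR_conv_of_real)
  obtain f g where "tree_iso_by f g (shabat_tree P 0 1) (shabat_tree Q 0 1)"
    using iso unfolding tree_iso_iff by blast
  note iso = tree_iso_byD[OF this]
  have edges: "edges (shabat_tree P 0 1) = ?EP" "edges (shabat_tree Q 0 1) = ?EQ"
    by (simp_all add: shabat_tree_def vimage_def)
  have g: "bij_betw g ?EP ?EQ" using iso(4) unfolding edges .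
  have mid: "midpoint 0 1 = (1/2::complex)" by (simp add: midpoint_def scaleR_conv_of_real)
  have bn: "lift_turn P 0 (1/2) e e' \<longleftrightarrow> lift_turn Q 0 (1/2) (g e) (g e')"
    if "e \<in> ?EP" "e' \<in> ?EP" for e e'
    using iso(6)[unfolded edges, OF that] by (simp add: shabat_tree_def mid)
  have wn: "lift_turn P 1 (1/2) e e' \<longleftrightarrow> lift_turn Q 1 (1/2) (g e) (g e')"
    if "e \<in> ?EP" "e' \<in> ?EP" for e e'
    using iso(7)[unfolded edges, OF that] by (simp add: shabat_tree_def mid)
  define edge where "edge = connected_component_set (poly P -` ?I)"
  \<comment> \<open>The unique point over 1/2 on the edge that corresponds to the edge of
    \<open>\<mu>\<close>.\<close>
  define G where "G = (\<lambda>\<mu>. THE z. z \<in> g (edge \<mu>) \<and> poly Q z = 1/2)"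
  have edge: "edge \<mu> \<in> ?EP" "\<mu> \<in> edge \<mu>" if "poly P \<mu> = 1/2" for \<mu>
  proof -
    have "\<mu> \<in> poly P -` ?I" by (rule vimageI2) (simp only: that half)
    then show "edge \<mu> \<in> ?EP" "\<mu> \<in> edge \<mu>" unfolding edge_def by (simp_all only: componentsI mem_Collect_eq connected_component_refl)
  qed
  have gedge: "g (edge \<mu>) \<in> ?EQ" if "poly P \<mu> = 1/2" for \<mu>
    using bij_betwE[OF g] edge(1)[OF that] by blast
  have G: "G \<mu> \<in> g (edge \<mu>) \<and> poly Q (G \<mu>) = 1/2" if "poly P \<mu> = 1/2" for \<mu>
    unfolding G_def by (rule theI'[OF Q.components_lift[OF open_segment_sheet half gedge[OF that]]])
  have G_unique: "z = G \<mu>" if "poly P \<mu> = 1/2" "z \<in> g (edge \<mu>)" "poly Q z = 1/2" for z \<mu>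
    using Q.components_lift[OF open_segment_sheet half gedge[OF that(1)]] G[OF that(1)] that(2,3) by auto
  have "regular_poly_pair P Q G"
  proof
    show "poly P \<mu> = 1/2 \<Longrightarrow> poly Q (G \<mu>) = 1/2" for \<mu> using G by blast
    fix c \<mu> \<nu> assume c: "c = 0 \<or> c = (1::complex)" and t: "turn P c \<mu> \<nu>"
    from t obtain \<gamma> where \<gamma>: "path \<gamma>" "pathstart \<gamma> = \<mu>" "pathfinish \<gamma> = \<nu>"
      "\<And>t. t \<in> {0..1} \<Longrightarrow> poly P (\<gamma> t) = c + (1/2 - c) * cis (2 * pi * t)"
      unfolding turn_def by blast
    have \<mu>: "poly P \<mu> = 1/2" using \<gamma>(2) \<gamma>(4)[of 0] by (simp add: pathstart_def)
    have \<nu>: "poly P \<nu> = 1/2" using \<gamma>(3) \<gamma>(4)[of 1] by (simp add: pathfinish_def)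
    have "lift_turn P c (1/2) (edge \<mu>) (edge \<nu>)"
      unfolding lift_turn_def using \<gamma> edge(2)[OF \<mu>] edge(2)[OF \<nu>] by blast
    then have "lift_turn Q c (1/2) (g (edge \<mu>)) (g (edge \<nu>))"
      using c bn[OF edge(1)[OF \<mu>] edge(1)[OF \<nu>]] wn[OF edge(1)[OF \<mu>] edge(1)[OF \<nu>]] by blast
    then obtain \<delta> where \<delta>: "path \<delta>" "pathstart \<delta> \<in> g (edge \<mu>)" "pathfinish \<delta> \<in> g (edge \<nu>)"
      "\<And>t. t \<in> {0..1} \<Longrightarrow> poly Q (\<delta> t) = c + (1/2 - c) * cis (2 * pi * t)"
      unfolding lift_turn_def by blast
    \<comment> \<open>The lift in \<open>Q\<close> is only known to start somewhere on the edge, but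
      its starting point lies over 1/2, and the edge has just one such point.\<close>
    have "pathstart \<delta> = G \<mu>"
      by (rule G_unique[OF \<mu> \<delta>(2)]) (use \<delta>(4)[of 0] in \<open>simp add: pathstart_def\<close>)
    moreover have "pathfinish \<delta> = G \<nu>"
      by (rule G_unique[OF \<nu> \<delta>(3)]) (use \<delta>(4)[of 1] in \<open>simp add: pathfinish_def\<close>)
    ultimately show "turn Q c (G \<mu>) (G \<nu>)"
      unfolding turn_def using \<delta>(1,4) by blast
  qed
  then obtain p where p: "P = pcompose Q p" using regular_poly_pair.poly_factors_through by blast
  have "degree P = degree Q"
    using bij_betw_same_card[OF iso(4)] card_edges_shabat_tree(1)[OF P] card_edges_shabat_tree(1)[OF Q] by simp
  moreover have "degree P = degree Q * degree p" unfolding p by (simp add: degree_pcompose)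
  ultimately have "degree p = 1" using Q.degree_pos by simp
  then have "p = [:coeff p 0, coeff p 1:]"
    by (auto simp: poly_eq_iff coeff_pCons coeff_eq_0 split: nat.split)
  moreover have "coeff p 1 \<noteq> 0"
    using \<open>degree p = 1\<close> by (metis degree_0 leading_coeff_0_iff zero_neq_one)
  ultimately obtain a b where "p = [:b, a:]" "a \<noteq> 0" by blast
  then have "\<forall>z. poly P z = 1 * poly Q (a * z + b) + 0" by (simp add: p poly_pcompose algebra_simps)
  then show ?thesis
    unfolding shabat_equiv_iff_poly using \<open>a \<noteq> 0\<close>
    by (intro exI[of _ 1] exI[of _ a] exI[of _ 0] exI[of _ b]) simp
qed

lemma shabat_equiv_normalized:
  assumes "c1 \<noteq> c2"
  shows "\<exists>P'. shabat_equiv P c1 c2 P' 0 1"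
proof (intro exI)
  let ?A = "1 / (c2 - c1)"
  let ?P = "smult ?A (pcompose P [:0, 1:]) + [:- ?A * c1:]"
  have "?A \<noteq> 0" "0 = ?A * c1 + - ?A * c1" "1 = ?A * c2 + - ?A * c1"
    using assms by (simp_all add: diff_divide_distrib[symmetric])
  then show "shabat_equiv P c1 c2 ?P 0 1"
    unfolding shabat_equiv_def by (intro exI[of _ ?A] exI[of _ 1] exI[of _ "- ?A * c1"] exI[of _ 0]) simp
qed

text \<open>The half planes of the gluing are tied to the critical values 0 and 1. Both polynomials
  are therefore replaced by equivalent ones with these critical values, which changes neither tree
  up to isomorphism.\<close>

theorem tree_iso_imp_shabat_equiv:
  assumes P: "shabat P c1 c2" and Q: "shabat Q d1 d2"
    and iso: "tree_iso (shabat_tree P c1 c2) (shabat_tree Q d1 d2)"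
  shows "shabat_equiv P c1 c2 Q d1 d2"
proof -
  obtain P' where P': "shabat_equiv P c1 c2 P' 0 1"
    using shabat_equiv_normalized P unfolding shabat_def by blast
  obtain Q' where Q': "shabat_equiv Q d1 d2 Q' 0 1"
    using shabat_equiv_normalized Q unfolding shabat_def by blast
  have "tree_iso (shabat_tree Q' 0 1) (shabat_tree Q d1 d2)"
    by (rule shabat_equiv_imp_tree_iso[OF Q'])
  moreover have "tree_iso (shabat_tree Q d1 d2) (shabat_tree P c1 c2)"
    by (rule tree_iso_sym[OF iso])
  moreover have "tree_iso (shabat_tree P c1 c2) (shabat_tree P' 0 1)"
    by (rule shabat_equiv_imp_tree_iso[OF shabat_equiv_sym[OF P']])
  ultimately have "tree_iso (shabat_tree Q' 0 1) (shabat_tree P' 0 1)"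
    by (blast intro: tree_iso_trans)
  then have "shabat_equiv P' 0 1 Q' 0 1"
    by (rule rigidity_normalized[OF shabat_equiv_shabat[OF Q' Q] shabat_equiv_shabat[OF P' P]])
  then show ?thesis
    using P' shabat_equiv_sym[OF Q'] by (blast intro: shabat_equiv_trans)
qed

section \<open>The logarithmic derivative of the normal form\<close>

text \<open>The numerator of \<open>P' / P\<close> over the denominator \<open>A * B\<close>, for
  \<open>P = A^r * B^s\<close>. It accounts for the critical points beyond those forced by multiple
  roots of \<open>P\<close>.\<close>

definition logderiv_numerator :: "nat \<Rightarrow> nat \<Rightarrow> complex poly \<Rightarrow> complex poly \<Rightarrow> complex poly" where
  "logderiv_numerator r s A B = smult (of_nat r) (pderiv A * B) + smult (of_nat s) (A * pderiv B)"

lemma pderiv_power_mult_power: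
  assumes "r > 0" "s > 0"
  shows "pderiv (A ^ r * B ^ s) = A ^ (r - 1) * B ^ (s - 1) * logderiv_numerator r s A B"
proof -
  obtain k l where rs: "r = Suc k" "s = Suc l" using assms by (meson gr0_conv_Suc)
  show ?thesis
    unfolding logderiv_numerator_def rs pderiv_mult pderiv_power_Suc
    by (simp add: algebra_simps del: of_nat_Suc)
qed

lemma logderiv_numerator_coeffs:
  "logderiv_numerator r s [:a0, a1, a2, 1:] [:b0, b1, 1:] =
     [: of_nat r * a1 * b0 + of_nat s * a0 * b1,
        of_nat r * (2 * a2 * b0 + a1 * b1) + of_nat s * (a1 * b1 + 2 * a0),
        of_nat r * (3 * b0 + 2 * a2 * b1 + a1) + of_nat s * (a2 * b1 + 2 * a1),
        of_nat r * (3 * b1 + 2 * a2) + of_nat s * (b1 + 2 * a2),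
        3 * of_nat r + 2 * of_nat s :]"
  by (simp add: logderiv_numerator_def pderiv_pCons algebra_simps)

lemma smult_linear_power4:
  "smult N ([:- z, 1:] ^ 4) = [: N * z^4, - 4 * N * z^3, 6 * N * z^2, - 4 * N * z, N :]"
  for N z :: "'a::comm_ring_1"
  by (simp add: numeral_eq_Suc algebra_simps)

lemma pcompose_power: "pcompose (p ^ n) q = pcompose p q ^ n"
  for p q :: "'a::comm_semiring_1 poly"
  by (induction n) (simp_all add: pcompose_mult pcompose_1)

text \<open>The substitution contributes \<open>e^5\<close> from \<open>A\<close> and
  \<open>B\<close> on the left; on the right there are \<open>e\<close> from the chain rule and
  \<open>e^4\<close> from the fourth power. These cancel, so \<open>N\<close> is unchanged and
  \<open>z\<close> moves to its preimage under the substitution.\<close>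

lemma logderiv_numerator_pcompose:
  assumes W: "logderiv_numerator r s A B = smult N ([:- z, 1:] ^ 4)" and "e \<noteq> 0"
    and A: "pcompose A [:f, e:] = smult (e ^ 3) A'" and B: "pcompose B [:f, e:] = smult (e ^ 2) B'"
  shows "logderiv_numerator r s A' B' = smult N ([:- ((z - f) / e), 1:] ^ 4)"
proof -
  let ?l = "[:f, e:]"
  have dA: "smult (e ^ 3) (pderiv A') = smult e (pcompose (pderiv A) ?l)"
    using arg_cong[OF A, of pderiv] by (simp add: pderiv_pcompose pderiv_smult pderiv_pCons)
  have dB: "smult (e ^ 2) (pderiv B') = smult e (pcompose (pderiv B) ?l)"
    using arg_cong[OF B, of pderiv] by (simp add: pderiv_pcompose pderiv_smult pderiv_pCons)
  have "smult (e ^ 5) (logderiv_numerator r s A' B') =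
      smult (of_nat r) (smult (e ^ 3) (pderiv A') * smult (e ^ 2) B') +
      smult (of_nat s) (smult (e ^ 3) A' * smult (e ^ 2) (pderiv B'))"
    by (simp add: logderiv_numerator_def smult_add_right mult_ac flip: power_add)
  also have "\<dots> = smult e (pcompose (logderiv_numerator r s A B) ?l)"
    unfolding dA dB A[symmetric] B[symmetric]
    by (simp add: logderiv_numerator_def pcompose_add pcompose_smult pcompose_mult smult_add_right mult_ac)
  also have "\<dots> = smult e (smult N ([:f - z, e:] ^ 4))"
  proof -
    have "pcompose [:- z, 1:] ?l = [:f - z, e:]" by (simp add: pcompose_pCons)
    then show ?thesis unfolding W by (simp only: pcompose_smult pcompose_power)
  qed
  also have "[:f - z, e:] = smult e [:- ((z - f) / e), 1:]"
    using \<open>e \<noteq> 0\<close> by simp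
  also have "smult e (smult N (smult e q ^ 4)) = smult (e ^ 5) (smult N (q ^ 4))" for q
    by (simp add: smult_power[symmetric] mult_ac power_numeral_reduce power2_eq_square)
  finally show ?thesis using \<open>e \<noteq> 0\<close> by (metis power_not_zero smult_cancel)
qed

lemma pcompose_cubic:
  fixes a0 a1 a2 e f :: "'a::comm_ring_1"
  shows "pcompose [:a0, a1, a2, 1:] [:f, e:] =
    [:poly [:a0, a1, a2, 1:] f, e * (3 * f^2 + 2 * a2 * f + a1), e^2 * (3 * f + a2), e^3:]"
  by (simp add: pcompose_pCons algebra_simps power2_eq_square power3_eq_cube)

lemma pcompose_quadratic:
  fixes b0 b1 e f :: "'a::comm_ring_1"
  shows "pcompose [:b0, b1, 1:] [:f, e:] = [:poly [:b0, b1, 1:] f, e * (2 * f + b1), e^2:]"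
  by (simp add: pcompose_pCons algebra_simps power2_eq_square)

lemma of_nat_pos_combination:
  assumes "r > 0 \<and> k > 0 \<or> s > 0 \<and> l > 0"
  shows "of_nat k * of_nat r + of_nat l * of_nat s \<noteq> (0::complex)"
proof -
  have "k * r + l * s \<noteq> 0" using assms by auto
  then have "of_nat (k * r + l * s) \<noteq> (0::complex)" by (simp only: of_nat_eq_0_iff not_False_eq_True)
  then show ?thesis by simp
qed

text \<open>This places the fourfold root away from the black vertices. After a shift of
  \<open>z\<close> to 0 the four lower coefficients vanish; a root of either factor at 0 would then
  make one of the subleading coefficients vanish, hence both, although
  \<open>3 * b1 - 2 * a2\<close> is invariant under shifts.\<close>

lemma logderiv_numerator_nonroot:
  assumes "r > 0" "s > 0"
    and W: "logderiv_numerator r s [:a0, a1, a2, 1:] [:b0, b1, 1:] = smult N ([:- z, 1:] ^ 4)"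
    and ne: "3 * b1 \<noteq> 2 * a2"
  shows "poly [:a0, a1, a2, 1:] z \<noteq> 0" "poly [:b0, b1, 1:] z \<noteq> 0"
proof -
  define \<alpha>0 \<alpha>1 \<alpha>2 \<beta>0 \<beta>1 where def: "\<alpha>0 = poly [:a0, a1, a2, 1:] z" "\<alpha>1 = 3 * z^2 + 2 * a2 * z + a1"
    "\<alpha>2 = 3 * z + a2" "\<beta>0 = poly [:b0, b1, 1:] z" "\<beta>1 = 2 * z + b1"
  define R S :: complex where RS: "R = of_nat r" "S = of_nat s"
  have "logderiv_numerator r s [:\<alpha>0, \<alpha>1, \<alpha>2, 1:] [:\<beta>0, \<beta>1, 1:] = smult N ([:- ((z - z) / 1), 1:] ^ 4)"
    by (rule logderiv_numerator_pcompose[OF W]) (simp_all only: pcompose_cubic pcompose_quadratic def, simp_all)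
  then have "logderiv_numerator r s [:\<alpha>0, \<alpha>1, \<alpha>2, 1:] [:\<beta>0, \<beta>1, 1:] = smult N ([:- 0, 1:] ^ 4)" by simp
  then have eq: "R * \<alpha>1 * \<beta>0 + S * \<alpha>0 * \<beta>1 = 0"
    "R * (2 * \<alpha>2 * \<beta>0 + \<alpha>1 * \<beta>1) + S * (\<alpha>1 * \<beta>1 + 2 * \<alpha>0) = 0"
    "R * (3 * \<beta>0 + 2 * \<alpha>2 * \<beta>1 + \<alpha>1) + S * (\<alpha>2 * \<beta>1 + 2 * \<alpha>1) = 0"
    "R * (3 * \<beta>1 + 2 * \<alpha>2) + S * (\<beta>1 + 2 * \<alpha>2) = 0"
    unfolding logderiv_numerator_coeffs smult_linear_power4 RS by simp_all
  have nz: "R \<noteq> 0" "S \<noteq> 0" using assms by (simp_all add: RS)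
  have comb: "R + S \<noteq> 0" "2 * R + S \<noteq> 0" "R + 2 * S \<noteq> 0" "3 * R + S \<noteq> 0" "2 * R + 2 * S \<noteq> 0"
    using of_nat_pos_combination[of r 1 s 1] of_nat_pos_combination[of r 2 s 1]
      of_nat_pos_combination[of r 1 s 2] of_nat_pos_combination[of r 3 s 1]
      of_nat_pos_combination[of r 2 s 2] assms by (simp_all add: RS)
  have e4: "(3 * R + S) * \<beta>1 + (2 * R + 2 * S) * \<alpha>2 = 0" using eq(4) by (simp add: algebra_simps)
  have inv: "3 * \<beta>1 \<noteq> 2 * \<alpha>2" using ne by (simp add: def)
  \<comment> \<open>By \<open>e4\<close>, either of the two vanishing forces the other to vanish,
    against \<open>inv\<close>.\<close>
  have both: False if "\<beta>1 = 0 \<or> \<alpha>2 = 0"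
    using that e4 comb inv by auto
  have \<alpha>0: "\<alpha>0 \<noteq> 0"
  proof
    assume 0: "\<alpha>0 = 0"
    then have "\<alpha>1 = 0 \<or> \<beta>0 = 0" using eq(1) nz by auto
    moreover have "(R + S) * (\<alpha>1 * \<beta>1) + 2 * R * (\<alpha>2 * \<beta>0) = 0" using eq(2) 0 by (simp add: algebra_simps)
    ultimately have "\<alpha>1 = 0 \<and> \<beta>0 = 0" using both comb nz by auto
    moreover from this have "(2 * R + S) * (\<alpha>2 * \<beta>1) = 0" using eq(3) by (simp add: algebra_simps)
    ultimately show False using both comb by auto
  qed
  have \<beta>0: "\<beta>0 \<noteq> 0"
  proof
    assume "\<beta>0 = 0"
    then have "\<beta>1 = 0" using eq(1) \<open>\<alpha>0 \<noteq> 0\<close> nz by auto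
    then show False by (rule both[OF disjI1])
  qed
  show "poly [:a0, a1, a2, 1:] z \<noteq> 0" using \<alpha>0 unfolding def .
  show "poly [:b0, b1, 1:] z \<noteq> 0" using \<beta>0 unfolding def .
qed

text \<open>
  If the subleading coefficients could both be shifted to 0, the cubic would be a cube.
\<close>

lemma logderiv_numerator_spread:
  assumes "r > 0" "s > 0"
    and W: "logderiv_numerator r s [:a0, a1, a2, 1:] [:b0, b1, 1:] = smult N ([:- z, 1:] ^ 4)"
    and sq: "rsquarefree [:a0, a1, a2, 1:]"
  shows "3 * b1 \<noteq> 2 * a2"
proof
  assume eq0: "3 * b1 = 2 * a2"
  \<comment> \<open>Under \<open>eq0\<close> this is both \<open>- a2 / 3\<close> and
    \<open>- b1 / 2\<close>, so one shift removes both subleading coefficients.\<close>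
  define f where "f = b1 - a2"
  define c b a where def: "c = 3 * f^2 + 2 * a2 * f + a1" "b = poly [:b0, b1, 1:] f" "a = poly [:a0, a1, a2, 1:] f"
  define R S :: complex where RS: "R = of_nat r" "S = of_nat s"
  have f: "3 * f + a2 = 0" "2 * f + b1 = 0" using eq0 by (simp_all add: f_def)
  have "logderiv_numerator r s [:a, c, 0, 1:] [:b, 0, 1:] = smult N ([:- ((z - f) / 1), 1:] ^ 4)"
    by (rule logderiv_numerator_pcompose[OF W])
      (simp_all only: pcompose_cubic pcompose_quadratic def f, simp_all)
  moreover define z' where "z' = z - f"
  ultimately have "logderiv_numerator r s [:a, c, 0, 1:] [:b, 0, 1:] = smult N ([:- z', 1:] ^ 4)"
    by (simp only: div_by_1)
  then have eqs: "R * c * b + S * a * 0 = N * z'^4" "R * (2 * 0 * b + c * 0) + S * (c * 0 + 2 * a) = - 4 * N * z'^3"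
      "R * (3 * b + 2 * 0 * 0 + c) + S * (0 * 0 + 2 * c) = 6 * N * z'^2"
      "R * (3 * 0 + 2 * 0) + S * (0 + 2 * 0) = - 4 * N * z'" "3 * R + 2 * S = N"
    unfolding logderiv_numerator_coeffs smult_linear_power4 RS pCons_eq_iff by blast+
  have nz: "R \<noteq> 0" "S \<noteq> 0" "3 * R + 2 * S \<noteq> 0" "R + 2 * S \<noteq> 0"
    using assms of_nat_pos_combination[of r 3 s 2] of_nat_pos_combination[of r 1 s 2] by (simp_all add: RS)
  \<comment> \<open>Without subleading coefficients the cubic coefficient of the quartic is 0, which
    puts its fourfold root at 0. The remaining equations then force the shifted cubic to be
    \<open>x^3\<close>.\<close>
  have "z' = 0" using nz(3) eqs(4) unfolding eqs(5) by simp
  with eqs have "R * c * b = 0" "2 * S * a = 0" "R * (3 * b + c) + 2 * S * c = 0"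
    by (simp_all add: mult_ac)
  moreover from this have "c = 0 \<or> b = 0" using nz by auto
  moreover have "R * (3 * b + c) + 2 * S * c = 3 * R * b + (R + 2 * S) * c" by (simp add: algebra_simps)
  ultimately have "a = 0" "c = 0" using nz by auto
  then have "poly [:a0, a1, a2, 1:] f = 0" "poly (pderiv [:a0, a1, a2, 1:]) f = 0"
    unfolding def by (simp_all add: pderiv_pCons algebra_simps power2_eq_square)
  then show False using sq unfolding rsquarefree_roots by blast
qed

text \<open>
  Here \<open>N\<close> is the degree, \<open>m = 5 R + 3 S\<close> comes from \<open>z = - m / (4 N)\<close>, and the right-hand side is the
  formulas for \<open>b\<close> and \<open>a\<close> with denominators cleared. The three equations on the left, multiplied by
  \<open>8 N\<close>, \<open>48 N^2\<close> and \<open>768 N^3\<close>, form a triangular combination of those on the right.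
\<close>

lemma logderiv_numerator_normal_form:
  fixes R S a b c d N m z D :: complex
  assumes nz: "R \<noteq> 0" "S \<noteq> 0" "N \<noteq> 0"
    and N: "N = 3 * R + 2 * S" and m: "m = 5 * R + 3 * S" and z: "4 * N * z = - m" and d: "c * N = 3 * d"
    and D: "D = 3 * m^4 - 96 * N * d * (27 * R^2 + (- 24 * d + 34 * S) * R - 48 * S * d + 11 * S^2)
       - 8 * N * (- 7 * S^3 + (96 * d + R) * S^2 + (48 * d * R + 51 * R^2) * S - 144 * R^2 * d + 51 * R^3)"
  shows "(R * (3 * b + 2 + c) + S * (1 + 2 * c) = 6 * N * z^2 \<and>
      R * (2 * b + c) + S * (c + 2 * a) = - 4 * N * z^3 \<and>
      R * c * b + S * a = N * z^4) \<longleftrightarrow>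
    (24 * R * N * b = 27 * R^2 + (- 24 * d + 34 * S) * R - 48 * S * d + 11 * S^2 \<and>
     96 * S * N^2 * a = - 7 * S^3 + (96 * d + R) * S^2 + (48 * d * R + 51 * R^2) * S - 144 * R^2 * d + 51 * R^3 \<and>
     D = 0)"
proof -
  define bn where "bn = 27 * R^2 + (- 24 * d + 34 * S) * R - 48 * S * d + 11 * S^2"
  define an where "an = - 7 * S^3 + (96 * d + R) * S^2 + (48 * d * R + 51 * R^2) * S - 144 * R^2 * d + 51 * R^3"
  have z2: "16 * N^2 * z^2 = m^2" and z3: "64 * N^3 * z^3 = - (m^3)" and z4: "256 * N^4 * z^4 = m^4"
    using arg_cong[OF z, of "\<lambda>x. x^2"] arg_cong[OF z, of "\<lambda>x. x^3"] arg_cong[OF z, of "\<lambda>x. x^4"]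
    by (simp_all add: power_mult_distrib)
  have E2: "8 * N * (R * (3 * b + 2 + c) + S * (1 + 2 * c) - 6 * N * z^2) = 24 * R * N * b - bn"
  proof -
    have "8 * N * (R * (3 * b + 2 + c) + S * (1 + 2 * c) - 6 * N * z^2) =
        24 * R * N * b + 8 * N * (2 * R + S) + 8 * (c * N) * (R + 2 * S) - 3 * (16 * N^2 * z^2)"
      by (simp add: algebra_simps power2_eq_square)
    also have "\<dots> = 24 * R * N * b - bn"
      unfolding z2 d by (simp add: N m bn_def algebra_simps power2_eq_square)
    finally show ?thesis .
  qed
  have E3: "48 * N^2 * (R * (2 * b + c) + S * (c + 2 * a) - (- 4 * N * z^3)) =
      4 * N * (24 * R * N * b - bn) + (96 * S * N^2 * a - an)"
  proof -
    have "48 * N^2 * (R * (2 * b + c) + S * (c + 2 * a) - (- 4 * N * z^3)) =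
        4 * N * (24 * R * N * b) + 48 * N * (c * N) * (R + S) + 96 * S * N^2 * a + 3 * (64 * N^3 * z^3)"
      by (simp add: algebra_simps power2_eq_square power3_eq_cube)
    also have "\<dots> = 4 * N * (24 * R * N * b - bn) + (96 * S * N^2 * a - an)"
      unfolding z3 d by (simp add: N m bn_def an_def algebra_simps power2_eq_square power3_eq_cube)
    finally show ?thesis .
  qed
  have E4: "768 * N^3 * (R * c * b + S * a - N * z^4) =
      96 * N * d * (24 * R * N * b - bn) + 8 * N * (96 * S * N^2 * a - an) - D"
  proof -
    have "768 * N^3 * (R * c * b + S * a - N * z^4) =
        32 * N * (c * N) * (24 * R * N * b) + 8 * N * (96 * S * N^2 * a) - 3 * (256 * N^4 * z^4)"
      by (simp add: algebra_simps power2_eq_square power3_eq_cube power4_eq_xxxx)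
    also have "\<dots> = 96 * N * d * (24 * R * N * b - bn) + 8 * N * (96 * S * N^2 * a - an) - D"
      unfolding z4 d D bn_def[symmetric] an_def[symmetric] by (simp add: algebra_simps)
    finally show ?thesis .
  qed
  have "(R * (3 * b + 2 + c) + S * (1 + 2 * c) = 6 * N * z^2) \<longleftrightarrow> 24 * R * N * b - bn = 0"
    unfolding E2[symmetric] using nz by simp
  moreover have "(R * (2 * b + c) + S * (c + 2 * a) = - 4 * N * z^3) \<longleftrightarrow>
      4 * N * (24 * R * N * b - bn) + (96 * S * N^2 * a - an) = 0"
    unfolding E3[symmetric] using nz by (simp add: eq_neg_iff_add_eq_0)
  moreover have "(R * c * b + S * a = N * z^4) \<longleftrightarrow>
      96 * N * d * (24 * R * N * b - bn) + 8 * N * (96 * S * N^2 * a - an) - D = 0"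
    unfolding E4[symmetric] using nz by simp
  ultimately show ?thesis unfolding bn_def[symmetric] an_def[symmetric] by auto
qed

text \<open>This is the origin of \<open>D\<close>: the right-hand side is, up to sign and the
  factor \<open>768 N^3\<close>, what the comparison of constant coefficients leaves once
  \<open>a\<close> and \<open>b\<close> are eliminated.\<close>

lemma D_poly_eq:
  "poly (D_poly R S) d = 3 * (5 * R + 3 * S)^4
     - 96 * (3 * R + 2 * S) * d * (27 * R^2 + (- 24 * d + 34 * S) * R - 48 * S * d + 11 * S^2)
     - 8 * (3 * R + 2 * S) * (- 7 * S^3 + (96 * d + R) * S^2 + (48 * d * R + 51 * R^2) * S - 144 * R^2 * d + 51 * R^3)"
  by (simp add: D_poly_def algebra_simps power2_eq_square power3_eq_cube power4_eq_xxxx)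

text \<open>The leading coefficients agree by the choice of \<open>N\<close>. With both subleading
  coefficients equal to 1 the cubic ones involve no unknown but \<open>z\<close>: they are
  \<open>(3 + 2) R + (1 + 2) S\<close> and \<open>- 4 N z\<close>.\<close>

lemma logderiv_numerator_eq_iff:
  fixes r s :: nat and a b c z N :: complex
  defines "R \<equiv> complex_of_nat r" and "S \<equiv> complex_of_nat s"
  assumes N: "N = 3 * R + 2 * S"
  shows "logderiv_numerator r s [:a, c, 1, 1:] [:b, 1, 1:] = smult N ([:- z, 1:] ^ 4) \<longleftrightarrow>
     4 * N * z = - (5 * R + 3 * S) \<and>
     (R * (3 * b + 2 + c) + S * (1 + 2 * c) = 6 * N * z^2 \<and>
      R * (2 * b + c) + S * (c + 2 * a) = - 4 * N * z^3 \<and>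
      R * c * b + S * a = N * z^4)"
proof -
  have "R * (3 * 1 + 2 * 1) + S * (1 + 2 * 1) = - 4 * N * z \<longleftrightarrow> 4 * N * z = - (5 * R + 3 * S)"
    by (auto simp: algebra_simps eq_neg_iff_add_eq_0)
  then show ?thesis
    unfolding logderiv_numerator_coeffs smult_linear_power4 pCons_eq_iff R_def[symmetric] S_def[symmetric]
    by (auto simp: N)
qed

lemma coeffs_iff:
  fixes R S a b c d :: complex
  assumes nz: "R \<noteq> 0" "S \<noteq> 0" "3 * R + 2 * S \<noteq> 0"
  defines "N \<equiv> 3 * R + 2 * S"
  shows "a = coeff_a R S d \<longleftrightarrow>
      96 * S * N^2 * a = - 7 * S^3 + (96 * d + R) * S^2 + (48 * d * R + 51 * R^2) * S - 144 * R^2 * d + 51 * R^3"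
    and "b = coeff_b R S d \<longleftrightarrow>
      24 * R * N * b = 27 * R^2 + (- 24 * d + 34 * S) * R - 48 * S * d + 11 * S^2"
    and "c = coeff_c R S d \<longleftrightarrow> c * N = 3 * d"
proof -
  have den: "72 * R^2 + 48 * R * S = 24 * R * N" by (simp add: N_def algebra_simps power2_eq_square)
  have "N \<noteq> 0" using nz by (simp add: N_def)
  then have nz': "96 * S * N^2 \<noteq> 0" "24 * R * N \<noteq> 0" using nz by simp_all
  show "a = coeff_a R S d \<longleftrightarrow>
      96 * S * N^2 * a = - 7 * S^3 + (96 * d + R) * S^2 + (48 * d * R + 51 * R^2) * S - 144 * R^2 * d + 51 * R^3"
    unfolding coeff_a_def N_def[symmetric] nonzero_eq_divide_eq[OF nz'(1)] by (simp only: mult.commute)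
  show "b = coeff_b R S d \<longleftrightarrow>
      24 * R * N * b = 27 * R^2 + (- 24 * d + 34 * S) * R - 48 * S * d + 11 * S^2"
    unfolding coeff_b_def den nonzero_eq_divide_eq[OF nz'(2)] by (simp only: mult.commute)
  show "c = coeff_c R S d \<longleftrightarrow> c * N = 3 * d"
    unfolding coeff_c_def N_def[symmetric] nonzero_eq_divide_eq[OF \<open>N \<noteq> 0\<close>] ..
qed

lemma logderiv_numerator_coeffs_of_root:
  assumes "r > 0" "s > 0"
  defines "R \<equiv> complex_of_nat r" and "S \<equiv> complex_of_nat s"
  assumes d: "poly (D_poly R S) d = 0"
  shows "\<exists>z. logderiv_numerator r s [:coeff_a R S d, coeff_c R S d, 1, 1:] [:coeff_b R S d, 1, 1:] =
     smult (3 * R + 2 * S) ([:- z, 1:] ^ 4)"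
proof -
  have nz: "R \<noteq> 0" "S \<noteq> 0" "3 * R + 2 * S \<noteq> 0"
    using assms of_nat_pos_combination[of r 3 s 2] by (simp_all add: R_def S_def)
  define z where "z = - (5 * R + 3 * S) / (4 * (3 * R + 2 * S))"
  have z: "4 * (3 * R + 2 * S) * z = - (5 * R + 3 * S)"
  proof -
    have "4 * (3 * R + 2 * S) \<noteq> 0" using nz(3) by (metis mult_eq_0_iff zero_neq_numeral)
    from nonzero_mult_div_cancel_left[OF this] show ?thesis
      unfolding z_def times_divide_eq_right .
  qed
  note co = coeffs_iff[OF nz]
  have "logderiv_numerator r s [:coeff_a R S d, coeff_c R S d, 1, 1:] [:coeff_b R S d, 1, 1:] =
     smult (3 * R + 2 * S) ([:- z, 1:] ^ 4)"
    unfolding R_def S_def logderiv_numerator_eq_iff[OF refl] unfolding R_def[symmetric] S_def[symmetric]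
    unfolding logderiv_numerator_normal_form[OF nz refl refl z co(3)[THEN iffD1, OF refl] D_poly_eq]
    using z co(1)[THEN iffD1, OF refl] co(2)[THEN iffD1, OF refl] d by blast
  then show ?thesis ..
qed

lemma logderiv_numerator_imp_coeffs:
  assumes "r > 0" "s > 0"
  defines "R \<equiv> complex_of_nat r" and "S \<equiv> complex_of_nat s"
  assumes W: "logderiv_numerator r s [:a, c, 1, 1:] [:b, 1, 1:] = smult (3 * R + 2 * S) ([:- z, 1:] ^ 4)"
  shows "\<exists>d. poly (D_poly R S) d = 0 \<and> a = coeff_a R S d \<and> b = coeff_b R S d \<and> c = coeff_c R S d"
proof -
  have nz: "R \<noteq> 0" "S \<noteq> 0" "3 * R + 2 * S \<noteq> 0"
    using assms of_nat_pos_combination[of r 3 s 2] by (simp_all add: R_def S_def)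
  note co = coeffs_iff[OF nz]
  \<comment> \<open>The formula for \<open>c\<close> solved for \<open>d\<close>; thus
    \<open>d\<close> is only a rescaled \<open>c\<close>, and every normal form has one.\<close>
  define d where "d = c * (3 * R + 2 * S) / 3"
  have d: "c * (3 * R + 2 * S) = 3 * d" by (simp add: d_def)
  have eqs: "4 * (3 * R + 2 * S) * z = - (5 * R + 3 * S)"
     "R * (3 * b + 2 + c) + S * (1 + 2 * c) = 6 * (3 * R + 2 * S) * z^2 \<and>
      R * (2 * b + c) + S * (c + 2 * a) = - 4 * (3 * R + 2 * S) * z^3 \<and>
      R * c * b + S * a = (3 * R + 2 * S) * z^4"
    using W unfolding R_def S_def logderiv_numerator_eq_iff[OF refl] by blast+
  show ?thesis
    using eqs(2) unfolding logderiv_numerator_normal_form[OF nz refl refl eqs(1) d D_poly_eq]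
    using co(1,2) co(3)[THEN iffD2, OF d] by blast
qed

lemma D_poly_roots:
  assumes "r > 0" "s > 0"
  shows "\<exists>d1 d2. d1 \<noteq> d2 \<and> {x. poly (D_poly (of_nat r) (of_nat s)) x = 0} = {d1, d2}"
proof -
  define R S :: complex where "R = of_nat r" "S = of_nat s"
  define A2 A1 A0 where
    "A2 = 6912 * R^2 + 18432 * R * S + 9216 * S^2"
    "A1 = - 4320 * R^3 - 13824 * R^2 * S - 12768 * R * S^2 - 3648 * S^3"
    "A0 = 651 * R^4 + 2460 * R^3 * S + 3210 * R^2 * S^2 + 1772 * R * S^3 + 355 * S^4"
  have D: "D_poly R S = [:A0, A1, A2:]" by (simp add: D_poly_def A2_A1_A0_def)
  have "A2 = of_nat (6912 * r^2 + 18432 * r * s + 9216 * s^2)" by (simp add: A2_A1_A0_def R_S_def)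
  then have A2: "A2 \<noteq> 0" using assms by (simp only: of_nat_eq_0_iff) simp
  define \<delta> where "\<delta> = A1^2 - 4 * A2 * A0"
  \<comment> \<open>As a polynomial in \<open>r\<close> and \<open>s\<close> the discriminant has
    only positive coefficients, so it cannot vanish.\<close>
  have "\<delta> = of_nat (663552 * r^6 + 3428352 * r^5 * s + 7299072 * r^4 * s^2 + 8183808 * r^3 * s^3
      + 5087232 * r^2 * s^4 + 1658880 * r * s^5 + 221184 * s^6)"
    by (simp add: \<delta>_def A2_A1_A0_def R_S_def) (simp add: algebra_simps eval_nat_numeral)
  then have \<delta>: "\<delta> \<noteq> 0" using assms by (simp only: of_nat_eq_0_iff) simp
  define q where "q = csqrt \<delta>"
  have q: "q^2 = \<delta>" "q \<noteq> 0" using \<delta> by (auto simp: q_def)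
  have "poly (D_poly R S) x = 0 \<longleftrightarrow> x \<in> {(- A1 + q) / (2 * A2), (- A1 - q) / (2 * A2)}" for x
  proof -
    have "4 * A2 * poly (D_poly R S) x = (2 * A2 * x + A1)^2 - q^2"
      unfolding q(1) \<delta>_def D by (simp add: algebra_simps power2_eq_square)
    also have "\<dots> = (2 * A2 * x + A1 - q) * (2 * A2 * x + A1 + q)" by (simp add: algebra_simps power2_eq_square)
    finally have "poly (D_poly R S) x = 0 \<longleftrightarrow> 2 * A2 * x + A1 - q = 0 \<or> 2 * A2 * x + A1 + q = 0"
      using A2 by (metis mult_eq_0_iff zero_neq_numeral)
    moreover have "2 * A2 * x + A1 - q = 0 \<longleftrightarrow> x = (- A1 + q) / (2 * A2)"
      using A2 by (auto simp: field_simps)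
    moreover have "2 * A2 * x + A1 + q = 0 \<longleftrightarrow> x * (2 * A2) = - A1 - q"
    proof
      assume "2 * A2 * x + A1 + q = 0"
      then show "x * (2 * A2) = - A1 - q" by algebra
    next
      assume "x * (2 * A2) = - A1 - q"
      then show "2 * A2 * x + A1 + q = 0" by algebra
    qed
    then have "2 * A2 * x + A1 + q = 0 \<longleftrightarrow> x = (- A1 - q) / (2 * A2)"
      using A2 by (simp add: nonzero_eq_divide_eq)
    ultimately show ?thesis by simp
  qed
  then have "{x. poly (D_poly R S) x = 0} = {(- A1 + q) / (2 * A2), (- A1 - q) / (2 * A2)}" by blast
  moreover have "(- A1 + q) / (2 * A2) \<noteq> (- A1 - q) / (2 * A2)" using q A2 by simp
  ultimately show ?thesis unfolding R_S_def by blast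
qed

section \<open>Vertex degrees of the normal form\<close>

lemma order_power: "p \<noteq> 0 \<Longrightarrow> order x (p ^ n) = n * order x p"
  by (induction n) (simp_all add: order_mult)

lemma sum_order_eq_degree:
  fixes p :: "complex poly"
  assumes "p \<noteq> 0"
  shows "(\<Sum>z | poly p z = 0. order z p) = degree p"
proof -
  have "degree p = degree (smult (lead_coeff p) (\<Prod>z | poly p z = 0. [:- z, 1:] ^ order z p))"
    by (simp only: complex_poly_decompose)
  also have "\<dots> = (\<Sum>z | poly p z = 0. order z p)"
    using assms by (simp add: degree_prod_sum_eq degree_power_eq)
  finally show ?thesis by simp
qed

text \<open>A multiple root of \<open>A\<close> or of \<open>B\<close>, or a common root of both,
  would be a root of the quartic and hence equal to \<open>z\<close>, which is a root of neither. So
  the roots of \<open>P\<close> have the prescribed orders, and \<open>z\<close> is the only other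
  critical point.\<close>

lemma normal_form_passport:
  assumes rs: "r > 0" "s > 0"
    and W: "logderiv_numerator r s [:a0, a1, a2, 1:] [:b0, b1, 1:] = smult (3 * of_nat r + 2 * of_nat s) ([:- z, 1:] ^ 4)"
    and ne: "3 * b1 \<noteq> 2 * a2"
  defines "P \<equiv> [:a0, a1, a2, 1:] ^ r * [:b0, b1, 1:] ^ s" and "w \<equiv> poly ([:a0, a1, a2, 1:] ^ r * [:b0, b1, 1:] ^ s) z"
  shows "rsquarefree [:a0, a1, a2, 1:]" "rsquarefree [:b0, b1, 1:]"
    "order x P = r * (if poly [:a0, a1, a2, 1:] x = 0 then 1 else 0) + s * (if poly [:b0, b1, 1:] x = 0 then 1 else 0)"
    "poly [:a0, a1, a2, 1:] x \<noteq> 0 \<or> poly [:b0, b1, 1:] x \<noteq> 0"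
    "shabat P 0 w"
    "has_passport (shabat_tree P 0 w) (replicate_mset 3 r + replicate_mset 2 s)
       ({#5#} + replicate_mset (3 * r + 2 * s - 5) 1) (3 * r + 2 * s)"
    "poly (pderiv P) z = 0" "poly P z \<noteq> 0"
proof -
  define A B where AB: "A = [:a0, a1, a2, 1:]" "B = [:b0, b1, 1:]"
  have P: "P = A ^ r * B ^ s" and w: "w = poly P z" by (simp_all only: P_def w_def AB)
  define N where "N = 3 * complex_of_nat r + 2 * complex_of_nat s"
  have N: "N \<noteq> 0" using of_nat_pos_combination[of r 3 s 2] rs by (simp add: N_def)
  have W': "logderiv_numerator r s A B = smult N ([:- z, 1:] ^ 4)" using W by (simp only: AB N_def)
  have nr: "poly A z \<noteq> 0" "poly B z \<noteq> 0" using logderiv_numerator_nonroot[OF rs W ne] unfolding AB by blast+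
  have Wz: "poly (logderiv_numerator r s A B) x = 0 \<longleftrightarrow> x = z" for x
    unfolding W' using N by simp
  have Wx: "poly (logderiv_numerator r s A B) x = of_nat r * (poly (pderiv A) x * poly B x) +
      of_nat s * (poly A x * poly (pderiv B) x)" for x
    by (simp add: logderiv_numerator_def)
  have sqA: "rsquarefree A"
    unfolding rsquarefree_roots
  proof (intro allI notI)
    fix x assume x: "poly A x = 0 \<and> poly (pderiv A) x = 0"
    then have "poly (logderiv_numerator r s A B) x = 0" unfolding Wx by simp
    then show False using x nr unfolding Wz by simp
  qed
  have sqB: "rsquarefree B"
    unfolding rsquarefree_roots
  proof (intro allI notI)
    fix x assume x: "poly B x = 0 \<and> poly (pderiv B) x = 0"
    then have "poly (logderiv_numerator r s A B) x = 0" unfolding Wx by simp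
    then show False using x nr unfolding Wz by simp
  qed
  have cop: "poly A x \<noteq> 0 \<or> poly B x \<noteq> 0" for x
    using Wz[of x] Wx[of x] nr by auto
  show "rsquarefree [:a0, a1, a2, 1:]" "rsquarefree [:b0, b1, 1:]"
    "poly [:a0, a1, a2, 1:] x \<noteq> 0 \<or> poly [:b0, b1, 1:] x \<noteq> 0"
    using sqA sqB cop[of x] unfolding AB by blast+
  have nz: "A \<noteq> 0" "B \<noteq> 0" by (simp_all add: AB)
  have deg: "degree A = 3" "degree B = 2" by (simp_all add: AB)
  have P0: "P \<noteq> 0" using nz by (simp add: P)
  have degP: "degree P = 3 * r + 2 * s"
    using nz deg by (simp add: P degree_mult_eq degree_power_eq)
  have ordA: "order x A = (if poly A x = 0 then 1 else 0)" for x
    using rsquarefree_root_order[OF sqA _ nz(1)] by (auto intro: order_0I)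
  have ordB: "order x B = (if poly B x = 0 then 1 else 0)" for x
    using rsquarefree_root_order[OF sqB _ nz(2)] by (auto intro: order_0I)
  have ordP: "order x P = r * (if poly A x = 0 then 1 else 0) + s * (if poly B x = 0 then 1 else 0)" for x
    using P0 nz by (simp add: P order_mult order_power ordA ordB)
  then show "order x P = r * (if poly [:a0, a1, a2, 1:] x = 0 then 1 else 0) + s * (if poly [:b0, b1, 1:] x = 0 then 1 else 0)"
    unfolding AB .
  have dP: "pderiv P = A ^ (r - 1) * B ^ (s - 1) * smult N ([:- z, 1:] ^ 4)"
    unfolding P pderiv_power_mult_power[OF rs] W' ..
  show w0: "poly P z \<noteq> 0" using nr by (simp add: P)
  show dPz: "poly (pderiv P) z = 0" by (simp add: dP)
  have crit: "poly P x = 0 \<or> x = z" if "poly (pderiv P) x = 0" for x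
  proof -
    have "poly (A ^ (r - 1) * B ^ (s - 1) * smult N ([:- z, 1:] ^ 4)) x = 0" using that unfolding dP .
    then show ?thesis using N rs by (auto simp: P)
  qed
  show sh: "shabat P 0 w"
    unfolding shabat_def using crit degP rs w0 w by auto
  have fA: "finite {x. poly A x = 0}" "card {x. poly A x = 0} = 3"
    using rsquarefree_card_roots[OF sqA] deg poly_roots_finite[OF nz(1)] by simp_all
  have fB: "finite {x. poly B x = 0}" "card {x. poly B x = 0} = 2"
    using rsquarefree_card_roots[OF sqB] deg poly_roots_finite[OF nz(2)] by simp_all
  have bl: "{x. poly P x = 0} = {x. poly A x = 0} \<union> {x. poly B x = 0}"
    using rs by (auto simp: P)
  have disj: "{x. poly A x = 0} \<inter> {x. poly B x = 0} = {}" using cop by auto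
  have const: "image_mset f (mset_set X) = replicate_mset (card X) k"
    if "finite X" "\<And>x. x \<in> X \<Longrightarrow> f x = k" for f :: "complex \<Rightarrow> nat" and X k
  proof -
    have "image_mset f (mset_set X) = image_mset (\<lambda>_. k) (mset_set X)"
      using that by (intro image_mset_cong) auto
    then show ?thesis by (simp add: image_mset_const_eq)
  qed
  have black: "image_mset (\<lambda>v. order v (P - [:poly P v:])) (mset_set {x. poly P x = 0}) =
      replicate_mset 3 r + replicate_mset 2 s"
  proof -
    have sub: "P - [:poly P x:] = P" if "poly P x = 0" for x using that by simp
    have oA: "order x (P - [:poly P x:]) = r" if "x \<in> {x. poly A x = 0}" for x
    proof -
      have "poly P x = 0" using that bl by blast
      from sub[OF this] show ?thesis using that cop[of x] ordP[of x] by simp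
    qed
    have oB: "order x (P - [:poly P x:]) = s" if "x \<in> {x. poly B x = 0}" for x
    proof -
      have "poly P x = 0" using that bl by blast
      from sub[OF this] show ?thesis using that cop[of x] ordP[of x] by simp
    qed
    have "image_mset (\<lambda>v. order v (P - [:poly P v:])) (mset_set {x. poly A x = 0}) = replicate_mset 3 r"
      using const[OF fA(1), of "\<lambda>v. order v (P - [:poly P v:])" r] oA unfolding fA(2) by blast
    moreover have "image_mset (\<lambda>v. order v (P - [:poly P v:])) (mset_set {x. poly B x = 0}) = replicate_mset 2 s"
      using const[OF fB(1), of "\<lambda>v. order v (P - [:poly P v:])" s] oB unfolding fB(2) by blast
    ultimately show ?thesis
      unfolding bl mset_set_Union[OF fA(1) fB(1) disj] image_mset_union by simp
  qed
  let ?Q = "P - [:w:]"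
  have degQ: "degree ?Q = 3 * r + 2 * s" using degP by (simp add: degree_diff_const)
  then have Q0: "?Q \<noteq> 0" using rs by auto
  have Qx: "poly ?Q x = 0 \<longleftrightarrow> poly P x = w" for x by simp
  have dQ: "pderiv ?Q = pderiv P" by (simp add: pderiv_diff)
  have dP0: "pderiv P \<noteq> 0" unfolding dP using nz N by simp
  \<comment> \<open>The derivative vanishes to order 4 at \<open>z\<close>, all of it from the
    quartic; the order of \<open>P - w\<close> is one more.\<close>
  have oz: "order z ?Q = 5"
  proof -
    have "order z (pderiv P) = order z (A ^ (r - 1)) + order z (B ^ (s - 1)) + order z ([:- z, 1:] ^ 4)"
      using dP0 N nz unfolding dP by (simp add: order_mult order_smult)
    also have "\<dots> = 4"
      using nr by (simp add: order_0I order_power_n_n)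
    finally have "order z (pderiv ?Q) = 4" unfolding dQ .
    then show ?thesis using order_pderiv[OF Q0, of z] w by simp
  qed
  have ox: "order x ?Q = 1" if "poly P x = w" "x \<noteq> z" for x
  proof -
    have "poly (pderiv P) x \<noteq> 0" using crit[of x] that w w0 by auto
    then have "order x (pderiv ?Q) = 0" unfolding dQ by (rule order_0I)
    then show ?thesis using order_pderiv[OF Q0, of x] that by simp
  qed
  define V where "V = {x. poly P x = w} - {z}"
  have Vz: "{x. poly P x = w} = insert z V" "z \<notin> V" using w by (auto simp: V_def)
  have fV: "finite V"
    using poly_roots_finite[OF Q0] unfolding Qx V_def by simp
  \<comment> \<open>The multiplicities over \<open>w\<close> add up to the degree; 5 of it belongs
    to \<open>z\<close>, and every other point contributes 1.\<close>
  have "3 * r + 2 * s = (\<Sum>x\<in>insert z V. order x ?Q)"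
    using sum_order_eq_degree[OF Q0] degQ unfolding Qx Vz(1) by simp
  also have "\<dots> = 5 + (\<Sum>x\<in>V. order x ?Q)" using fV Vz(2) oz by simp
  also have "(\<Sum>x\<in>V. order x ?Q) = card V" using ox by (simp add: V_def)
  finally have cV: "card V = 3 * r + 2 * s - 5" by simp
  have white: "image_mset (\<lambda>v. order v (P - [:poly P v:])) (mset_set {x. poly P x = w}) =
      {#5#} + replicate_mset (3 * r + 2 * s - 5) 1"
  proof -
    have "image_mset (\<lambda>v. order v (P - [:poly P v:])) (mset_set V) = replicate_mset (card V) 1"
      using ox by (intro const[OF fV]) (auto simp: V_def)
    then show ?thesis unfolding Vz(1) using fV Vz(2) oz w cV by simp
  qed
  have finB: "finite {x. poly P x = 0}" unfolding bl using fA fB by simp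
  have finW: "finite {x. poly P x = w}" unfolding Vz(1) using fV by simp
  show "has_passport (shabat_tree P 0 w) (replicate_mset 3 r + replicate_mset 2 s)
       ({#5#} + replicate_mset (3 * r + 2 * s - 5) 1) (3 * r + 2 * s)"
    unfolding has_passport_def
    using finB finW black white card_edges_shabat_tree[OF sh] degP
    by (simp add: shabat_tree_def)
qed

section \<open>Trees with the given passport\<close>

text \<open>At the white vertex of degree 5 the derivative vanishes to order 4. Neither
  \<open>A\<close> nor \<open>B\<close> vanishes there, so the fourth power divides the numerator of
  the logarithmic derivative, which has degree 4 and is thereby determined up to a constant.\<close>

lemma passport_factorization:
  assumes rs: "r > 0" "s > 0" "r \<noteq> s"
    and Q: "shabat Q c1 c2"
    and pass: "has_passport (shabat_tree Q c1 c2) (replicate_mset 3 r + replicate_mset 2 s) \<beta> n"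
    and \<beta>: "5 \<in># \<beta>"
  obtains k a0 a1 a2 b0 b1 z where "k \<noteq> 0"
    "Q - [:c1:] = smult k ([:a0, a1, a2, 1:] ^ r * [:b0, b1, 1:] ^ s)"
    "rsquarefree [:a0, a1, a2, 1:]"
    "logderiv_numerator r s [:a0, a1, a2, 1:] [:b0, b1, 1:] = smult (3 * of_nat r + 2 * of_nat s) ([:- z, 1:] ^ 4)"
proof -
  define X where "X = {z. poly Q z = c1}"
  define f where "f = (\<lambda>v. order v (Q - [:c1:]))"
  let ?Q = "Q - [:c1:]"
  have deg: "degree ?Q > 0" using Q by (simp add: degree_diff_const shabat_def)
  then have Q0: "?Q \<noteq> 0" by auto
  have finX: "finite X" using Q by (simp add: X_def finite_poly_fibre shabat_def)
  have f: "image_mset f (mset_set X) = replicate_mset 3 r + replicate_mset 2 s"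
  proof -
    have "image_mset f (mset_set X) = image_mset (\<lambda>v. order v (Q - [:poly Q v:])) (mset_set X)"
      using finX by (intro image_mset_cong) (simp add: X_def f_def)
    then show ?thesis using pass by (simp add: has_passport_def shabat_tree_def X_def)
  qed
  have card: "card {v \<in> X. f v = k} = count (replicate_mset 3 r + replicate_mset 2 s) k" for k
  proof -
    have "count (image_mset f (mset_set X)) k = size (filter_mset (\<lambda>v. f v = k) (mset_set X))"
      by (simp add: count_conv_size_mset filter_mset_image_mset eq_commute)
    then show ?thesis unfolding f using finX by (simp add: filter_mset_mset_set)
  qed
  define U V where UV: "U = {v \<in> X. f v = r}" "V = {v \<in> X. f v = s}"
  \<comment> \<open>Here \<open>r \<noteq> s\<close> enters: the degree tells the three black
    vertices in \<open>U\<close> from the two in \<open>V\<close>.\<close>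
  have cU: "card U = 3" and cV: "card V = 2"
    using card[of r] card[of s] rs by (simp_all add: UV)
  have fUV: "finite U" "finite V" using finX by (simp_all add: UV)
  have "f v \<in># replicate_mset 3 r + replicate_mset 2 s" if "v \<in> X" for v
    using that finX unfolding f[symmetric] by simp
  then have XUV: "X = U \<union> V" by (auto simp: UV dest!: in_replicate_mset[THEN iffD1])
  have disj: "U \<inter> V = {}" using rs by (auto simp: UV)
  define k where "k = lead_coeff ?Q"
  have k: "k \<noteq> 0" using Q0 unfolding k_def by (simp only: leading_coeff_0_iff not_False_eq_True)
  have "?Q = smult k (\<Prod>v | poly ?Q v = 0. [:- v, 1:] ^ order v ?Q)"
    by (simp only: k_def complex_poly_decompose)
  also have "{v. poly ?Q v = 0} = U \<union> V" unfolding XUV[symmetric] by (simp add: X_def)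
  also have "(\<Prod>v\<in>U \<union> V. [:- v, 1:] ^ order v ?Q) =
      (\<Prod>v\<in>U. [:- v, 1:] ^ f v) * (\<Prod>v\<in>V. [:- v, 1:] ^ f v)"
    unfolding prod.union_disjoint[OF fUV disj] f_def ..
  also have "(\<Prod>v\<in>U. [:- v, 1:] ^ f v) = (\<Prod>v\<in>U. [:- v, 1:]) ^ r"
    unfolding prod_power_distrib by (intro prod.cong) (auto simp: UV)
  also have "(\<Prod>v\<in>V. [:- v, 1:] ^ f v) = (\<Prod>v\<in>V. [:- v, 1:]) ^ s"
    unfolding prod_power_distrib by (intro prod.cong) (auto simp: UV)
  finally have fact: "?Q = smult k ((\<Prod>v\<in>U. [:- v, 1:]) ^ r * (\<Prod>v\<in>V. [:- v, 1:]) ^ s)" .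
  obtain u1 u2 u3 where U: "U = {u1, u2, u3}" "u1 \<noteq> u2" "u1 \<noteq> u3" "u2 \<noteq> u3"
    using cU by (auto simp: card_3_iff)
  obtain v1 v2 where V: "V = {v1, v2}" "v1 \<noteq> v2"
    using cV by (auto simp: card_2_iff)
  define a0 a1 a2 b0 b1 where coeffs: "a0 = - (u1 * u2 * u3)" "a1 = u1 * u2 + u1 * u3 + u2 * u3"
    "a2 = - (u1 + u2 + u3)" "b0 = v1 * v2" "b1 = - (v1 + v2)"
  define A B where AB: "A = [:a0, a1, a2, 1:]" "B = [:b0, b1, 1:]"
  have A: "(\<Prod>v\<in>U. [:- v, 1:]) = A" using U by (simp add: AB coeffs algebra_simps)
  have B: "(\<Prod>v\<in>V. [:- v, 1:]) = B" using V by (simp add: AB coeffs algebra_simps)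
  have fact: "?Q = smult k (A ^ r * B ^ s)" using fact unfolding A B .
  have sq: "rsquarefree A"
    unfolding rsquarefree_roots
  proof (intro allI notI)
    fix x assume x: "poly A x = 0 \<and> poly (pderiv A) x = 0"
    have "poly A x = (x - u1) * ((x - u2) * (x - u3))"
      "poly (pderiv A) x = (x - u2) * (x - u3) + (x - u1) * (x - u3) + (x - u1) * (x - u2)"
      by (simp_all add: AB coeffs pderiv_pCons algebra_simps)
    then show False using x U(2-4) by auto
  qed
  obtain z where z: "poly Q z = c2" "order z (Q - [:c2:]) = 5"
  proof -
    have "\<exists>z\<in>{z. poly Q z = c2}. order z (Q - [:poly Q z:]) = 5"
    proof -
      have "5 \<in># image_mset (\<lambda>v. order v (Q - [:poly Q v:])) (mset_set {z. poly Q z = c2})"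
        using pass \<beta> by (simp add: has_passport_def shabat_tree_def)
      moreover have "finite {z. poly Q z = c2}" using Q by (simp add: finite_poly_fibre shabat_def)
      ultimately show ?thesis by auto
    qed
    then show ?thesis using that by auto
  qed
  have Q2: "Q - [:c2:] \<noteq> 0" using deg degree_diff_const[of Q c1] degree_diff_const[of Q c2] by auto
  have "order z (pderiv Q) = 4"
    using order_pderiv[OF Q2, of z] z by (simp add: pderiv_diff)
  then have o4: "order z (pderiv ?Q) = 4" by (simp add: pderiv_diff)
  have "poly ?Q z \<noteq> 0" using z Q by (auto simp: shabat_def)
  then have nz: "poly A z \<noteq> 0" "poly B z \<noteq> 0" unfolding fact using rs by auto
  define N where "N = 3 * complex_of_nat r + 2 * complex_of_nat s"
  have N: "N \<noteq> 0" using of_nat_pos_combination[of r 3 s 2] rs by (simp add: N_def)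
  define W where "W = logderiv_numerator r s A B"
  have lW: "degree W = 4" "coeff W 4 = N"
    using N unfolding W_def AB logderiv_numerator_coeffs N_def by (simp_all add: eval_nat_numeral)
  then have W0: "W \<noteq> 0" by auto
  have AB0: "A \<noteq> 0" "B \<noteq> 0" by (simp_all add: AB)
  have dQ: "pderiv ?Q = smult k (A ^ (r - 1) * B ^ (s - 1) * W)"
    unfolding fact pderiv_smult pderiv_power_mult_power[OF rs(1,2)] W_def ..
  have "order z (pderiv ?Q) = order z (A ^ (r - 1)) + order z (B ^ (s - 1)) + order z W"
    unfolding dQ using k AB0 W0 by (simp add: order_smult order_mult)
  also have "order z (A ^ (r - 1)) = 0" using nz by (intro order_0I) simp
  also have "order z (B ^ (s - 1)) = 0" using nz by (intro order_0I) simp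
  finally have "order z W = 4" using o4 by simp
  then have "[:- z, 1:] ^ 4 dvd W" using order_1[of z W] by simp
  then obtain q where q: "W = [:- z, 1:] ^ 4 * q" by (elim dvdE)
  then have "q \<noteq> 0" using W0 by auto
  then have "degree W = 4 + degree q" unfolding q by (subst degree_mult_eq) (auto simp: degree_power_eq)
  then have "degree q = 0" using lW by simp
  then obtain h where h: "q = [:h:]" by (elim degree_eq_zeroE)
  have Wh: "W = smult h ([:- z, 1:] ^ 4)" by (simp add: q h)
  \<comment> \<open>Comparison of leading coefficients.\<close>
  have "h = N"
    using lW(2) unfolding Wh smult_linear_power4 by (simp add: eval_nat_numeral)
  then show thesis
    using that[OF k] fact sq Wh unfolding AB W_def N_def by blast
qed

text \<open>The substitution turns the subleading coefficients into
  \<open>e^2 * (3 * f + a2)\<close> and \<open>e * (2 * f + b1)\<close>. Both become 1 after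
  division by \<open>e^3\<close> and \<open>e^2\<close> iff
  \<open>3 * f + a2 = e = 2 * f + b1\<close>; the given \<open>e\<close> and \<open>f\<close> solve
  these equations.\<close>

lemma pcompose_normalize:
  fixes a0 a1 a2 b0 b1 :: complex
  assumes e: "e = 3 * b1 - 2 * a2" "e \<noteq> 0" and f: "f = b1 - a2"
  shows "pcompose [:a0, a1, a2, 1:] [:f, e:] = smult (e ^ 3)
      [:poly [:a0, a1, a2, 1:] f / e^3, (3 * f^2 + 2 * a2 * f + a1) / e^2, 1, 1:]"
    "pcompose [:b0, b1, 1:] [:f, e:] = smult (e ^ 2) [:poly [:b0, b1, 1:] f / e^2, 1, 1:]"
proof -
  have "3 * f + a2 = e" "2 * f + b1 = e" using e f by simp_all
  then show "pcompose [:a0, a1, a2, 1:] [:f, e:] = smult (e ^ 3)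
      [:poly [:a0, a1, a2, 1:] f / e^3, (3 * f^2 + 2 * a2 * f + a1) / e^2, 1, 1:]"
    "pcompose [:b0, b1, 1:] [:f, e:] = smult (e ^ 2) [:poly [:b0, b1, 1:] f / e^2, 1, 1:]"
    unfolding pcompose_cubic pcompose_quadratic using e(2)
    by (simp_all add: power2_eq_square power3_eq_cube)
qed

lemma passport_imp_P_poly:
  assumes rs: "r > 0" "s > 0" "r \<noteq> s"
    and Q: "shabat Q c1 c2"
    and pass: "has_passport (shabat_tree Q c1 c2) (replicate_mset 3 r + replicate_mset 2 s) \<beta> n"
    and \<beta>: "5 \<in># \<beta>"
  shows "\<exists>d w. poly (D_poly (of_nat r) (of_nat s)) d = 0 \<and> shabat_equiv (P_poly r s d) 0 w Q c1 c2"
proof -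
  obtain k a0 a1 a2 b0 b1 z where k: "k \<noteq> 0"
    and fact: "Q - [:c1:] = smult k ([:a0, a1, a2, 1:] ^ r * [:b0, b1, 1:] ^ s)"
    and sq: "rsquarefree [:a0, a1, a2, 1:]"
    and W: "logderiv_numerator r s [:a0, a1, a2, 1:] [:b0, b1, 1:] = smult (3 * of_nat r + 2 * of_nat s) ([:- z, 1:] ^ 4)"
    by (rule passport_factorization[OF rs Q pass \<beta>])
  define e f where ef: "e = 3 * b1 - 2 * a2" "f = b1 - a2"
  have e: "e \<noteq> 0" using logderiv_numerator_spread[OF rs(1,2) W sq] by (simp add: ef)
  define a c b where abc: "a = poly [:a0, a1, a2, 1:] f / e^3" "c = (3 * f^2 + 2 * a2 * f + a1) / e^2"
    "b = poly [:b0, b1, 1:] f / e^2"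
  have comp: "pcompose [:a0, a1, a2, 1:] [:f, e:] = smult (e ^ 3) [:a, c, 1, 1:]"
      "pcompose [:b0, b1, 1:] [:f, e:] = smult (e ^ 2) [:b, 1, 1:]"
    unfolding abc by (rule pcompose_normalize[OF ef(1) e ef(2)])+
  have "logderiv_numerator r s [:a, c, 1, 1:] [:b, 1, 1:] =
      smult (3 * of_nat r + 2 * of_nat s) ([:- ((z - f) / e), 1:] ^ 4)"
    by (rule logderiv_numerator_pcompose[OF W e comp])
  then obtain d where d: "poly (D_poly (of_nat r) (of_nat s)) d = 0"
      "a = coeff_a (of_nat r) (of_nat s) d" "b = coeff_b (of_nat r) (of_nat s) d"
      "c = coeff_c (of_nat r) (of_nat s) d"
    using logderiv_numerator_imp_coeffs[OF rs(1,2)] by blast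
  have P: "P_poly r s d = [:a, c, 1, 1:] ^ r * [:b, 1, 1:] ^ s"
    unfolding P_poly_def d(2-4) ..
  \<comment> \<open>The leading coefficient \<open>k\<close> times the powers of \<open>e\<close>
    that the \<open>r\<close> cubic and \<open>s\<close> quadratic factors release.\<close>
  define \<kappa> where "\<kappa> = k * (e ^ 3) ^ r * (e ^ 2) ^ s"
  have \<kappa>: "\<kappa> \<noteq> 0" using k e by (simp add: \<kappa>_def)
  have comp': "poly [:a0, a1, a2, 1:] (e * y + f) = e ^ 3 * poly [:a, c, 1, 1:] y"
     "poly [:b0, b1, 1:] (e * y + f) = e ^ 2 * poly [:b, 1, 1:] y" for y
  proof -
    have "poly [:f, e:] y = e * y + f" by simp
    then show "poly [:a0, a1, a2, 1:] (e * y + f) = e ^ 3 * poly [:a, c, 1, 1:] y"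
      "poly [:b0, b1, 1:] (e * y + f) = e ^ 2 * poly [:b, 1, 1:] y"
      using arg_cong[OF comp(1), of "\<lambda>p. poly p y"] arg_cong[OF comp(2), of "\<lambda>p. poly p y"]
      by (simp_all only: poly_pcompose poly_smult)
  qed
  have Qy: "poly Q (e * y + f) = \<kappa> * poly (P_poly r s d) y + c1" for y
  proof -
    have "poly Q (e * y + f) - c1 = k * (poly [:a0, a1, a2, 1:] (e * y + f) ^ r * poly [:b0, b1, 1:] (e * y + f) ^ s)"
      using arg_cong[OF fact, of "\<lambda>p. poly p (e * y + f)"]
      unfolding poly_diff poly_smult poly_mult poly_power by (simp only: poly_pCons poly_0 mult_zero_right add_0_right)
    also have "\<dots> = \<kappa> * poly (P_poly r s d) y"
      unfolding comp' P poly_mult poly_power \<kappa>_def power_mult_distrib by (simp only: mult_ac)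
    finally show ?thesis by (simp add: algebra_simps)
  qed
  have "poly Q x = \<kappa> * poly (P_poly r s d) ((1/e) * x + (- f/e)) + c1" for x
  proof -
    have "e * ((1/e) * x + (- f/e)) + f = x" using e by (simp add: field_simps)
    then show ?thesis using Qy[of "(1/e) * x + (- f/e)"] by simp
  qed
  \<comment> \<open>The white critical value of the normal form is the preimage of \<open>c2\<close>
    under the affine map of the values, which sends 0 to \<open>c1\<close>.\<close>
  moreover have "c1 = \<kappa> * 0 + c1" "c2 = \<kappa> * ((c2 - c1) / \<kappa>) + c1" using \<kappa> by simp_all
  moreover have "1/e \<noteq> 0" using e by simp
  ultimately have "shabat_equiv (P_poly r s d) 0 ((c2 - c1) / \<kappa>) Q c1 c2"
    unfolding shabat_equiv_iff_poly using \<kappa> by blast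
  then show ?thesis using d(1) by blast
qed

section \<open>Inequivalence of the two normal forms\<close>

lemma order_pcompose_linear:
  fixes P :: "'a::field poly"
  assumes "P \<noteq> 0" "a \<noteq> 0"
  shows "order z (pcompose P [:b, a:]) = order (a * z + b) P"
proof -
  let ?x = "a * z + b"
  obtain q where q: "P = [:- ?x, 1:] ^ order ?x P * q" "\<not> [:- ?x, 1:] dvd q"
    using order_decomp[OF assms(1)] by blast
  have lin: "pcompose [:- ?x, 1:] [:b, a:] = smult a [:- z, 1:]" by (simp add: pcompose_pCons)
  have eq: "pcompose P [:b, a:] = smult (a ^ order ?x P) ([:- z, 1:] ^ order ?x P * pcompose q [:b, a:])"
    using arg_cong[OF q(1), of "\<lambda>p. pcompose p [:b, a:]"]
    by (simp only: pcompose_mult pcompose_power lin smult_power mult_smult_left)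
  have "poly (pcompose q [:b, a:]) z \<noteq> 0"
    using q(2) by (simp add: poly_pcompose poly_eq_0_iff_dvd algebra_simps)
  moreover from this have "pcompose q [:b, a:] \<noteq> 0" by auto
  ultimately show ?thesis
    unfolding eq using assms(2) by (simp add: order_smult order_mult order_power_n_n order_0I)
qed

lemma rsquarefree_same_roots:
  fixes p q :: "complex poly"
  assumes "rsquarefree p" "rsquarefree q" "\<And>x. poly p x = 0 \<longleftrightarrow> poly q x = 0"
  shows "smult (lead_coeff q) p = smult (lead_coeff p) q"
proof -
  let ?m = "\<Prod>z|poly p z = 0. [:-z, 1:]"
  have p: "p = smult (lead_coeff p) ?m" and q: "q = smult (lead_coeff q) ?m"
    using complex_poly_decompose_rsquarefree[OF assms(1)] complex_poly_decompose_rsquarefree[OF assms(2)]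
    by (simp_all only: assms(3))
  have "smult (lead_coeff q) p = smult (lead_coeff q) (smult (lead_coeff p) ?m)"
    by (rule arg_cong[OF p])
  also have "\<dots> = smult (lead_coeff p) (smult (lead_coeff q) ?m)" by (simp only: smult_smult mult.commute)
  also have "\<dots> = smult (lead_coeff p) q" by (rule arg_cong[OF q[symmetric]])
  finally show ?thesis .
qed

lemma P_poly_properties:
  assumes rs: "r > 0" "s > 0" and d: "poly (D_poly (of_nat r) (of_nat s)) d = 0"
  defines "A \<equiv> [:coeff_a (of_nat r) (of_nat s) d, coeff_c (of_nat r) (of_nat s) d, 1, 1:]"
    and "B \<equiv> [:coeff_b (of_nat r) (of_nat s) d, 1, 1:]"
  shows "rsquarefree A" "rsquarefree B"
    "order x (P_poly r s d) = r * (if poly A x = 0 then 1 else 0) + s * (if poly B x = 0 then 1 else 0)"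
    "poly A x \<noteq> 0 \<or> poly B x \<noteq> 0"
    "\<exists>z. poly (pderiv (P_poly r s d)) z = 0 \<and> poly (P_poly r s d) z \<noteq> 0 \<and>
       shabat (P_poly r s d) 0 (poly (P_poly r s d) z) \<and>
       has_passport (shabat_tree (P_poly r s d) 0 (poly (P_poly r s d) z))
         (replicate_mset 3 r + replicate_mset 2 s)
         ({#5#} + replicate_mset (3 * r + 2 * s - 5) 1) (3 * r + 2 * s)"
proof -
  obtain z where W: "logderiv_numerator r s A B = smult (3 * of_nat r + 2 * of_nat s) ([:- z, 1:] ^ 4)"
    using logderiv_numerator_coeffs_of_root[OF rs d] unfolding A_def B_def by blast
  \<comment> \<open>With both subleading coefficients equal to 1, the premise left open reads
    \<open>3 * 1 \<noteq> 2 * 1\<close>.\<close>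
  note facts = normal_form_passport[OF rs W[unfolded A_def B_def], folded A_def B_def]
  have P: "P_poly r s d = A ^ r * B ^ s" by (simp only: P_poly_def A_def B_def)
  show "rsquarefree A" "rsquarefree B"
    "order x (P_poly r s d) = r * (if poly A x = 0 then 1 else 0) + s * (if poly B x = 0 then 1 else 0)"
    "poly A x \<noteq> 0 \<or> poly B x \<noteq> 0"
    unfolding P using facts by simp_all
  show "\<exists>z. poly (pderiv (P_poly r s d)) z = 0 \<and> poly (P_poly r s d) z \<noteq> 0 \<and>
       shabat (P_poly r s d) 0 (poly (P_poly r s d) z) \<and>
       has_passport (shabat_tree (P_poly r s d) 0 (poly (P_poly r s d) z))
         (replicate_mset 3 r + replicate_mset 2 s)
         ({#5#} + replicate_mset (3 * r + 2 * s - 5) 1) (3 * r + 2 * s)"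
    unfolding P using facts by (intro exI[of _ z] conjI) simp_all
qed

text \<open>The black value 0 is fixed, so the equivalence has no additive constant and its
  substitution preserves root orders. It therefore respects cubic and quadratic separately. Their
  normalized subleading coefficients give \<open>3 * b + 1 = a = 2 * b + 1\<close>; the substitution
  is the identity, and \<open>d\<close> is read off from \<open>c\<close>.\<close>

lemma P_poly_equiv_imp_eq:
  assumes rs: "r > 0" "s > 0" "r \<noteq> s"
    and d1: "poly (D_poly (of_nat r) (of_nat s)) d1 = 0" and d2: "poly (D_poly (of_nat r) (of_nat s)) d2 = 0"
    and equiv: "shabat_equiv (P_poly r s d1) 0 w1 (P_poly r s d2) 0 w2"
  shows "d1 = d2"
proof -
  define A B where AB: "A = (\<lambda>d. [:coeff_a (of_nat r) (of_nat s) d, coeff_c (of_nat r) (of_nat s) d, 1, 1:])"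
    "B = (\<lambda>d. [:coeff_b (of_nat r) (of_nat s) d, 1, 1:])"
  note p1 = P_poly_properties(1-4)[OF rs(1,2) d1, folded AB[THEN fun_cong]]
  note p2 = P_poly_properties(1-4)[OF rs(1,2) d2, folded AB[THEN fun_cong]]
  obtain k a h b where k: "k \<noteq> 0" and a: "a \<noteq> 0" and "P_poly r s d2 = smult k (pcompose (P_poly r s d1) [:b, a:]) + [:h:]"
      "0 = k * 0 + h"
    using equiv unfolding shabat_equiv_def by blast
  then have P2: "P_poly r s d2 = smult k (pcompose (P_poly r s d1) [:b, a:])" by simp
  have "P_poly r s d1 \<noteq> 0" by (simp add: P_poly_def)
  then have ord: "order x (P_poly r s d2) = order (a * x + b) (P_poly r s d1)" for x
    unfolding P2 using k a by (simp add: order_smult order_pcompose_linear)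
  \<comment> \<open>The possible orders 0, \<open>r\<close> and \<open>s\<close> are pairwise
    different, so the order of a point decides which factor vanishes there.\<close>
  have roots: "poly (A d2) x = 0 \<longleftrightarrow> poly (A d1) (a * x + b) = 0"
      "poly (B d2) x = 0 \<longleftrightarrow> poly (B d1) (a * x + b) = 0" for x
    using ord[of x] p1(3,4)[of "a * x + b"] p2(3,4)[of x] rs by (auto split: if_splits)
  have sqc: "rsquarefree (pcompose p [:b, a:])" if "rsquarefree p" for p :: "complex poly"
    using that a unfolding rsquarefree_roots
    by (auto simp: pderiv_pcompose poly_pcompose pderiv_pCons)
  have "smult (lead_coeff (A d2)) (pcompose (A d1) [:b, a:]) = smult (lead_coeff (pcompose (A d1) [:b, a:])) (A d2)"
    by (rule rsquarefree_same_roots[OF sqc[OF p1(1)] p2(1)])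
      (simp add: roots poly_pcompose add.commute mult.commute)
  then have "a^2 * (3 * b + 1) = a^3" and c: "a * (3 * b^2 + 2 * 1 * b + coeff_c (of_nat r) (of_nat s) d1) = a^3 * coeff_c (of_nat r) (of_nat s) d2"
    unfolding AB pcompose_cubic using a by simp_all
  then have 1: "3 * b + 1 = a" using a by (simp add: power2_eq_square power3_eq_cube)
  have "smult (lead_coeff (B d2)) (pcompose (B d1) [:b, a:]) = smult (lead_coeff (pcompose (B d1) [:b, a:])) (B d2)"
    by (rule rsquarefree_same_roots[OF sqc[OF p1(2)] p2(2)])
      (simp add: roots poly_pcompose add.commute mult.commute)
  then have "a * (2 * b + 1) = a^2"
    unfolding AB pcompose_quadratic using a by simp_all
  then have 2: "2 * b + 1 = a" using a by (simp add: power2_eq_square)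
  have "3 * b + 1 = 2 * b + 1" using 1 2 by simp
  then have "b = 0" by simp
  with 1 have "a = 1" by simp
  then have "coeff_c (of_nat r) (of_nat s) d1 = coeff_c (of_nat r) (of_nat s) d2" using c \<open>b = 0\<close> by simp
  moreover have "3 * complex_of_nat r + 2 * complex_of_nat s \<noteq> 0"
    using of_nat_pos_combination[of r 3 s 2] rs by simp
  ultimately show "d1 = d2" by (simp add: coeff_c_def)
qed

theorem lemma5p1:
  fixes r s n :: nat and \<alpha> \<beta> :: "nat multiset"
  assumes "r > 0" and "s > 0" and "r \<noteq> s" and "n = 3 * r + 2 * s"
    and "\<alpha> = replicate_mset 3 r + replicate_mset 2 s"
    and "\<beta> = {#5#} + replicate_mset (n - 5) 1"
  shows "\<exists>d1 d2 w1 w2.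
      d1 \<noteq> d2 \<and> {x. poly (D_poly (of_nat r) (of_nat s)) x = 0} = {d1, d2} \<and>
      shabat (P_poly r s d1) 0 w1 \<and> has_passport (shabat_tree (P_poly r s d1) 0 w1) \<alpha> \<beta> n \<and>
      shabat (P_poly r s d2) 0 w2 \<and> has_passport (shabat_tree (P_poly r s d2) 0 w2) \<alpha> \<beta> n \<and>
      \<not> tree_iso (shabat_tree (P_poly r s d1) 0 w1) (shabat_tree (P_poly r s d2) 0 w2) \<and>
      (\<forall>Q c1 c2. shabat Q c1 c2 \<and> has_passport (shabat_tree Q c1 c2) \<alpha> \<beta> n \<longrightarrow>
         (\<exists>(d, w)\<in>{(d1, w1), (d2, w2)}.
            tree_iso (shabat_tree Q c1 c2) (shabat_tree (P_poly r s d) 0 w) \<and>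
            shabat_equiv (P_poly r s d) 0 w Q c1 c2))"
proof -
  note rs = assms(1-3)
  obtain d1 d2 where d: "d1 \<noteq> d2" "{x. poly (D_poly (of_nat r) (of_nat s)) x = 0} = {d1, d2}"
    using D_poly_roots[OF rs(1,2)] by (elim exE conjE) (rule that)
  have "d1 \<in> {d1, d2}" "d2 \<in> {d1, d2}" by simp_all
  then have root: "poly (D_poly (of_nat r) (of_nat s)) d1 = 0" "poly (D_poly (of_nat r) (of_nat s)) d2 = 0"
    unfolding d(2)[symmetric] mem_Collect_eq .
  obtain z1 where z1: "poly (pderiv (P_poly r s d1)) z1 = 0" "poly (P_poly r s d1) z1 \<noteq> 0"
      "shabat (P_poly r s d1) 0 (poly (P_poly r s d1) z1)"
      "has_passport (shabat_tree (P_poly r s d1) 0 (poly (P_poly r s d1) z1)) \<alpha> \<beta> n"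
    using P_poly_properties(5)[OF rs(1,2) root(1)] unfolding assms(4-6) by blast
  obtain z2 where z2: "poly (pderiv (P_poly r s d2)) z2 = 0" "poly (P_poly r s d2) z2 \<noteq> 0"
      "shabat (P_poly r s d2) 0 (poly (P_poly r s d2) z2)"
      "has_passport (shabat_tree (P_poly r s d2) 0 (poly (P_poly r s d2) z2)) \<alpha> \<beta> n"
    using P_poly_properties(5)[OF rs(1,2) root(2)] unfolding assms(4-6) by blast
  let ?w1 = "poly (P_poly r s d1) z1" and ?w2 = "poly (P_poly r s d2) z2"
  have "\<not> tree_iso (shabat_tree (P_poly r s d1) 0 ?w1) (shabat_tree (P_poly r s d2) 0 ?w2)"
    using tree_iso_imp_shabat_equiv[OF z1(3) z2(3)] P_poly_equiv_imp_eq[OF rs root] d(1) by blast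
  moreover have "\<exists>(d, w)\<in>{(d1, ?w1), (d2, ?w2)}.
      tree_iso (shabat_tree Q c1 c2) (shabat_tree (P_poly r s d) 0 w) \<and>
      shabat_equiv (P_poly r s d) 0 w Q c1 c2"
    if Q: "shabat Q c1 c2" and pass: "has_passport (shabat_tree Q c1 c2) \<alpha> \<beta> n" for Q c1 c2
  proof -
    have "5 \<in># \<beta>" by (simp add: assms(6))
    then obtain d w where dw: "poly (D_poly (of_nat r) (of_nat s)) d = 0" "shabat_equiv (P_poly r s d) 0 w Q c1 c2"
      using passport_imp_P_poly[OF rs Q pass[unfolded assms(5)]] by blast
    have "shabat (P_poly r s d) 0 w" by (rule shabat_equiv_shabat[OF shabat_equiv_sym[OF dw(2)] Q])
    \<comment> \<open>This identifies \<open>w\<close>: both \<open>z1\<close> and \<open>z2\<close>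
      are critical points with nonzero value in their polynomials, and the only nonzero critical
      value allowed is \<open>w\<close>.\<close>
    then have crit: "poly (pderiv (P_poly r s d)) z = 0 \<Longrightarrow> poly (P_poly r s d) z \<noteq> 0 \<Longrightarrow> poly (P_poly r s d) z = w" for z
      unfolding shabat_def by blast
    have "d \<in> {x. poly (D_poly (of_nat r) (of_nat s)) x = 0}" using dw(1) by (rule CollectI)
    then have "d = d1 \<or> d = d2" unfolding d(2) by simp
    then have "(d, w) \<in> {(d1, ?w1), (d2, ?w2)}" using crit z1(1,2) z2(1,2) by auto
    then show ?thesis using shabat_equiv_imp_tree_iso[OF dw(2)] dw(2) by blast
  qed
  ultimately show ?thesis
    using d z1(3,4) z2(3,4) by blast
qed

end
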